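(* Let $G$ be a Lie group with Lie algebra $\mathfrak{g}$, and let $(g,J)$ be a left invariant almost anti-Hermitian structure on $G$ such that $J$ is bi-invariant, i.e. $[JX,Y]=J[X,Y]$ for all $X,Y\in\mathfrak{g}$. Then $(G,g,J)$ is an anti-Kähler manifold, i.e. $\nabla J=0$, where $\nabla$ is the Levi-Civita connection of $g$.
   Context: The Lie algebra $\mathfrak{g}$ of $G$ is the space of left invariant vector fields on $G$. A left invariant almost anti-Hermitian structure on $G$ is a pair $(g,J)$ where $g$ is a left invariant pseudo-Riemannian metric on $G$, $J$ is a left invariant almost complex structure on $G$ (so $J$ maps $\mathfrak{g}$ to $\mathfrak{g}$ and $J^2=-\mathrm{Id}$), and $g(JX,JY)=-g(X,Y)$ for all $X,Y$ (equivalently, $J$ is symmetric with respect to $g$). An almost anti-Hermitian manifold $(M,g,J)$ is called anti-Kähler if $J$ is parallel with respect to the Levi-Civita connection of $g$, where $(\nabla_XJ)Y=\nabla_X(JY)-J\nabla_XY$. *)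

theory Defs
  imports "HOL-Analysis.Analysis" "HOL-Algebra.Group"
begin

section \<open>Smooth manifolds\<close>

text \<open>
  Only used for open \<open>S\<close>. \<open>C_k_on k S f\<close> says that all iterated directional derivatives of \<open>f\<close>
  of order less than \<open>k\<close> are differentiable on \<open>S\<close>, those of order \<open>k\<close> being continuous; on a
  finite-dimensional space this is the usual \<open>C\<^sup>k\<close>.
\<close>

primrec C_k_on :: "nat \<Rightarrow> 'e::real_normed_vector set \<Rightarrow> ('e \<Rightarrow> 'f::real_normed_vector) \<Rightarrow> bool" where
  "C_k_on 0 S f \<longleftrightarrow> continuous_on S f"
| "C_k_on (Suc k) S f \<longleftrightarrow>
     (\<forall>x\<in>S. f differentiable (at x)) \<and> (\<forall>v. C_k_on k S (\<lambda>x. frechet_derivative f (at x) v))"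

definition smooth_on :: "'e::real_normed_vector set \<Rightarrow> ('e \<Rightarrow> 'f::real_normed_vector) \<Rightarrow> bool" where
  "smooth_on S f \<longleftrightarrow> (\<forall>k. C_k_on k S f)"

text \<open>
  The points of a manifold are all elements of a type, whose type-class topology is the manifold
  topology. A chart \<open>(U, \<phi>)\<close> has its inverse given by \<^term>\<open>inv_into U \<phi>\<close>; the values of
  \<open>\<phi>\<close> outside \<open>U\<close> are irrelevant.
\<close>

type_synonym ('a, 'e) chart = "'a set \<times> ('a \<Rightarrow> 'e)"

definition is_chart :: "('a::topological_space, 'e::euclidean_space) chart \<Rightarrow> bool" where
  "is_chart c \<longleftrightarrow> (case c of (U, \<phi>) \<Rightarrow>
     open U \<and> open (\<phi> ` U) \<and> homeomorphism U (\<phi> ` U) \<phi> (inv_into U \<phi>))"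

definition smooth_manifold ::
  "('a::{t2_space,second_countable_topology}, 'e::euclidean_space) chart set \<Rightarrow> bool" where
  "smooth_manifold A \<longleftrightarrow>
     (\<forall>c\<in>A. is_chart c) \<and> (\<Union>(fst ` A) = UNIV) \<and>
     (\<forall>(U, \<phi>)\<in>A. \<forall>(V, \<psi>)\<in>A. smooth_on (\<phi> ` (U \<inter> V)) (\<psi> \<circ> inv_into U \<phi>))"

definition smooth_map ::
  "('a::topological_space, 'e::euclidean_space) chart set \<Rightarrow>
   ('b::topological_space, 'f::euclidean_space) chart set \<Rightarrow> ('a \<Rightarrow> 'b) \<Rightarrow> bool" where
  "smooth_map A B F \<longleftrightarrow> continuous_on UNIV F \<and>
     (\<forall>(U, \<phi>)\<in>A. \<forall>(V, \<psi>)\<in>B. smooth_on (\<phi> ` (U \<inter> F -` V)) (\<psi> \<circ> F \<circ> inv_into U \<phi>))"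

definition smooth_functions ::
  "('a::topological_space, 'e::euclidean_space) chart set \<Rightarrow> ('a \<Rightarrow> real) set" where
  "smooth_functions A = {f. \<forall>(U, \<phi>)\<in>A. smooth_on (\<phi> ` U) (f \<circ> inv_into U \<phi>)}"

definition prod_atlas ::
  "('a, 'e) chart set \<Rightarrow> ('b, 'f) chart set \<Rightarrow> ('a \<times> 'b, 'e \<times> 'f) chart set" where
  "prod_atlas A B = {(U \<times> V, map_prod \<phi> \<psi>) | U \<phi> V \<psi>. (U, \<phi>) \<in> A \<and> (V, \<psi>) \<in> B}"

section \<open>Tangent vectors and vector fields\<close>

text \<open>
  Tangent vectors at \<open>p\<close> are the derivations at \<open>p\<close> of the algebra of smooth functions. They are
  made zero on non-smooth functions, so that equality of HOL functions is equality of tangent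
  vectors.
\<close>

type_synonym 'a tvec = "('a \<Rightarrow> real) \<Rightarrow> real"
type_synonym 'a vfield = "'a \<Rightarrow> 'a tvec"

definition lincomb :: "real \<Rightarrow> 'a tvec \<Rightarrow> real \<Rightarrow> 'a tvec \<Rightarrow> 'a tvec" where
  "lincomb a u b v = (\<lambda>f. a * u f + b * v f)"

definition tangent_space ::
  "('a::topological_space, 'e::euclidean_space) chart set \<Rightarrow> 'a \<Rightarrow> 'a tvec set" where
  "tangent_space A p = {v.
     (\<forall>f. f \<notin> smooth_functions A \<longrightarrow> v f = 0) \<and>
     (\<forall>f\<in>smooth_functions A. \<forall>h\<in>smooth_functions A. \<forall>a b.
        v (\<lambda>x. a * f x + b * h x) = a * v f + b * v h) \<and>
     (\<forall>f\<in>smooth_functions A. \<forall>h\<in>smooth_functions A.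
        v (\<lambda>x. f x * h x) = v f * h p + f p * v h)}"

definition vfields ::
  "('a::topological_space, 'e::euclidean_space) chart set \<Rightarrow> 'a vfield set" where
  "vfields A = {X. (\<forall>p. X p \<in> tangent_space A p) \<and>
     (\<forall>f\<in>smooth_functions A. (\<lambda>p. X p f) \<in> smooth_functions A)}"

definition vf_add :: "'a vfield \<Rightarrow> 'a vfield \<Rightarrow> 'a vfield" where
  "vf_add X Y = (\<lambda>p f. X p f + Y p f)"

definition vf_diff :: "'a vfield \<Rightarrow> 'a vfield \<Rightarrow> 'a vfield" where
  "vf_diff X Y = (\<lambda>p f. X p f - Y p f)"

definition vf_scale :: "('a \<Rightarrow> real) \<Rightarrow> 'a vfield \<Rightarrow> 'a vfield" where
  "vf_scale h X = (\<lambda>p f. h p * X p f)"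

definition lie_bracket :: "'a vfield \<Rightarrow> 'a vfield \<Rightarrow> 'a vfield" where
  "lie_bracket X Y = (\<lambda>p f. X p (\<lambda>q. Y q f) - Y p (\<lambda>q. X q f))"

text \<open>The differential of \<open>F : M \<rightarrow> N\<close>; \<open>B\<close> is the atlas of the target \<open>N\<close>.\<close>

definition push_forward ::
  "('b::topological_space, 'f::euclidean_space) chart set \<Rightarrow> ('a \<Rightarrow> 'b) \<Rightarrow> 'a tvec \<Rightarrow> 'b tvec" where
  "push_forward B F v = (\<lambda>f. if f \<in> smooth_functions B then v (f \<circ> F) else 0)"

section \<open>Anti-Hermitian and anti-Kaehler structures\<close>

text \<open>A tensor of type (0,2) is a family of maps on pairs of tangent vectors, one of type (1,1) a
  family of maps on tangent vectors. Only their values on \<^const>\<open>tangent_space\<close> matter.\<close>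

type_synonym 'a bilin_field = "'a \<Rightarrow> 'a tvec \<Rightarrow> 'a tvec \<Rightarrow> real"
type_synonym 'a endo_field = "'a \<Rightarrow> 'a tvec \<Rightarrow> 'a tvec"

definition apply_endo :: "'a endo_field \<Rightarrow> 'a vfield \<Rightarrow> 'a vfield" where
  "apply_endo J X = (\<lambda>p. J p (X p))"

definition pseudo_riemannian ::
  "('a::topological_space, 'e::euclidean_space) chart set \<Rightarrow> 'a bilin_field \<Rightarrow> bool" where
  "pseudo_riemannian A g \<longleftrightarrow>
     (\<forall>p. \<forall>u\<in>tangent_space A p. \<forall>v\<in>tangent_space A p. g p u v = g p v u) \<and>
     (\<forall>p. \<forall>u\<in>tangent_space A p. \<forall>v\<in>tangent_space A p. \<forall>w\<in>tangent_space A p. \<forall>a b.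
        g p (lincomb a u b v) w = a * g p u w + b * g p v w) \<and>
     (\<forall>p. \<forall>u\<in>tangent_space A p. (\<forall>v\<in>tangent_space A p. g p u v = 0) \<longrightarrow> u = (\<lambda>f. 0)) \<and>
     (\<forall>X\<in>vfields A. \<forall>Y\<in>vfields A. (\<lambda>p. g p (X p) (Y p)) \<in> smooth_functions A)"

definition almost_complex ::
  "('a::topological_space, 'e::euclidean_space) chart set \<Rightarrow> 'a endo_field \<Rightarrow> bool" where
  "almost_complex A J \<longleftrightarrow>
     (\<forall>p. \<forall>u\<in>tangent_space A p. J p u \<in> tangent_space A p) \<and>
     (\<forall>p. \<forall>u\<in>tangent_space A p. \<forall>v\<in>tangent_space A p. \<forall>a b.
        J p (lincomb a u b v) = lincomb a (J p u) b (J p v)) \<and>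
     (\<forall>p. \<forall>u\<in>tangent_space A p. J p (J p u) = (\<lambda>f. - u f)) \<and>
     (\<forall>X\<in>vfields A. apply_endo J X \<in> vfields A)"

definition almost_anti_hermitian ::
  "('a::topological_space, 'e::euclidean_space) chart set \<Rightarrow> 'a bilin_field \<Rightarrow> 'a endo_field \<Rightarrow> bool"
  where
  "almost_anti_hermitian A g J \<longleftrightarrow> pseudo_riemannian A g \<and> almost_complex A J \<and>
     (\<forall>p. \<forall>u\<in>tangent_space A p. \<forall>v\<in>tangent_space A p. g p (J p u) (J p v) = - g p u v)"

definition affine_connection ::
  "('a::topological_space, 'e::euclidean_space) chart set \<Rightarrow>
   ('a vfield \<Rightarrow> 'a vfield \<Rightarrow> 'a vfield) \<Rightarrow> bool" where
  "affine_connection A nab \<longleftrightarrow>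
     (\<forall>X\<in>vfields A. \<forall>Y\<in>vfields A. nab X Y \<in> vfields A) \<and>
     (\<forall>X\<in>vfields A. \<forall>X'\<in>vfields A. \<forall>Y\<in>vfields A.
        nab (vf_add X X') Y = vf_add (nab X Y) (nab X' Y)) \<and>
     (\<forall>X\<in>vfields A. \<forall>Y\<in>vfields A. \<forall>h\<in>smooth_functions A.
        nab (vf_scale h X) Y = vf_scale h (nab X Y)) \<and>
     (\<forall>X\<in>vfields A. \<forall>Y\<in>vfields A. \<forall>Y'\<in>vfields A.
        nab X (vf_add Y Y') = vf_add (nab X Y) (nab X Y')) \<and>
     (\<forall>X\<in>vfields A. \<forall>Y\<in>vfields A. \<forall>h\<in>smooth_functions A.
        nab X (vf_scale h Y) = vf_add (vf_scale (\<lambda>p. X p h) Y) (vf_scale h (nab X Y)))"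

definition levi_civita ::
  "('a::topological_space, 'e::euclidean_space) chart set \<Rightarrow> 'a bilin_field \<Rightarrow>
   ('a vfield \<Rightarrow> 'a vfield \<Rightarrow> 'a vfield) \<Rightarrow> bool" where
  "levi_civita A g nab \<longleftrightarrow> affine_connection A nab \<and>
     (\<forall>X\<in>vfields A. \<forall>Y\<in>vfields A. vf_diff (nab X Y) (nab Y X) = lie_bracket X Y) \<and>
     (\<forall>X\<in>vfields A. \<forall>Y\<in>vfields A. \<forall>Z\<in>vfields A. \<forall>p.
        X p (\<lambda>q. g q (Y q) (Z q)) = g p (nab X Y p) (Z p) + g p (Y p) (nab X Z p))"

definition cov_deriv_endo ::
  "('a vfield \<Rightarrow> 'a vfield \<Rightarrow> 'a vfield) \<Rightarrow> 'a endo_field \<Rightarrow> 'a vfield \<Rightarrow> 'a vfield \<Rightarrow> 'a vfield" where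
  "cov_deriv_endo nab J X Y = vf_diff (nab X (apply_endo J Y)) (apply_endo J (nab X Y))"

definition parallel_endo ::
  "('a::topological_space, 'e::euclidean_space) chart set \<Rightarrow>
   ('a vfield \<Rightarrow> 'a vfield \<Rightarrow> 'a vfield) \<Rightarrow> 'a endo_field \<Rightarrow> bool" where
  "parallel_endo A nab J \<longleftrightarrow>
     (\<forall>X\<in>vfields A. \<forall>Y\<in>vfields A. cov_deriv_endo nab J X Y = (\<lambda>p f. 0))"

text \<open>By the fundamental theorem of pseudo-Riemannian geometry there is exactly one Levi-Civita
  connection (as a map on \<^const>\<open>vfields\<close>). The HOL function representing it is arbitrary outside
  \<^const>\<open>vfields\<close>, which is why \<open>the Levi-Civita connection\<close> appears as a quantifier here.\<close>

definition anti_kaehler ::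
  "('a::{t2_space,second_countable_topology}, 'e::euclidean_space) chart set \<Rightarrow> 'a bilin_field \<Rightarrow>
   'a endo_field \<Rightarrow> bool" where
  "anti_kaehler A g J \<longleftrightarrow> smooth_manifold A \<and> almost_anti_hermitian A g J \<and>
     (\<forall>nab. levi_civita A g nab \<longrightarrow> parallel_endo A nab J)"

section \<open>Lie groups and left invariance\<close>

definition lie_group ::
  "('a::{t2_space,second_countable_topology}) monoid \<Rightarrow> ('a, 'e::euclidean_space) chart set \<Rightarrow> bool"
  where
  "lie_group G A \<longleftrightarrow> group G \<and> carrier G = UNIV \<and> smooth_manifold A \<and>
     smooth_map (prod_atlas A A) A (\<lambda>(a, b). a \<otimes>\<^bsub>G\<^esub> b) \<and> smooth_map A A (\<lambda>a. inv\<^bsub>G\<^esub> a)"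

definition d_left ::
  "'a monoid \<Rightarrow> ('a::topological_space, 'e::euclidean_space) chart set \<Rightarrow> 'a \<Rightarrow> 'a tvec \<Rightarrow> 'a tvec"
  where
  "d_left G A a = push_forward A (\<lambda>b. a \<otimes>\<^bsub>G\<^esub> b)"

definition lie_algebra ::
  "'a monoid \<Rightarrow> ('a::topological_space, 'e::euclidean_space) chart set \<Rightarrow> 'a vfield set" where
  "lie_algebra G A = {X \<in> vfields A. \<forall>a b. d_left G A a (X b) = X (a \<otimes>\<^bsub>G\<^esub> b)}"

definition left_inv_metric ::
  "'a monoid \<Rightarrow> ('a::topological_space, 'e::euclidean_space) chart set \<Rightarrow> 'a bilin_field \<Rightarrow> bool" where
  "left_inv_metric G A g \<longleftrightarrow>
     (\<forall>a b. \<forall>u\<in>tangent_space A b. \<forall>v\<in>tangent_space A b.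
        g (a \<otimes>\<^bsub>G\<^esub> b) (d_left G A a u) (d_left G A a v) = g b u v)"

definition left_inv_endo ::
  "'a monoid \<Rightarrow> ('a::topological_space, 'e::euclidean_space) chart set \<Rightarrow> 'a endo_field \<Rightarrow> bool" where
  "left_inv_endo G A J \<longleftrightarrow>
     (\<forall>a b. \<forall>u\<in>tangent_space A b. J (a \<otimes>\<^bsub>G\<^esub> b) (d_left G A a u) = d_left G A a (J b u))"

definition bi_invariant ::
  "'a monoid \<Rightarrow> ('a::topological_space, 'e::euclidean_space) chart set \<Rightarrow> 'a endo_field \<Rightarrow> bool" where
  "bi_invariant G A J \<longleftrightarrow>
     (\<forall>X\<in>lie_algebra G A. \<forall>Y\<in>lie_algebra G A.
        lie_bracket (apply_endo J X) Y = apply_endo J (lie_bracket X Y))"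

end

theory Submission
  imports Defs
begin

text \<open>
  Let \<open>T X Y = \<nabla>\<^bsub>X\<^esub> (J Y) - J (\<nabla>\<^bsub>X\<^esub> Y)\<close>. For left invariant fields the derivative terms of the Koszul
  formula vanish, so \<open>2 g (\<nabla>\<^bsub>X\<^esub> Y, Z)\<close> is a combination of \<open>g ([X, Y], Z)\<close>, \<open>g ([Y, Z], X)\<close> and
  \<open>g ([Z, X], Y)\<close>. As \<open>J\<close> is bi-invariant and \<open>g\<close>-symmetric, replacing any one argument \<open>W\<close> by \<open>J W\<close> has
  the same effect on each of these terms, whence \<open>g (T X Y, Z) = 0\<close>. Every tangent vector is the value of
  a left invariant field, so \<open>T X Y = 0\<close> for left invariant \<open>X\<close> and \<open>Y\<close>. Expanding an arbitrary \<open>X\<close> in a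
  left invariant frame and using that \<open>T X\<close> is \<open>g\<close>-symmetric removes the restriction on \<open>X\<close> and \<open>Y\<close>.

  Smoothness of the left invariant fields requires identifying derivations with directional
  derivatives in a chart, by means of bump functions and Hadamard's lemma.
\<close>

section \<open>Calculus of smooth maps\<close>

lemma has_derivative_frechet_cong:
  assumes "open S" "x \<in> S" "\<And>y. y \<in> S \<Longrightarrow> f y = g y" "f differentiable (at x)"
  shows "g differentiable (at x)" "frechet_derivative g (at x) = frechet_derivative f (at x)"
proof -
  have "(f has_derivative frechet_derivative f (at x)) (at x)"
    using assms(4) frechet_derivative_works by blast
  then have "(g has_derivative frechet_derivative f (at x)) (at x)"
    using has_derivative_transform_within_open[OF _ assms(1,2)] assms(3) by blast
  then show "g differentiable (at x)" "frechet_derivative g (at x) = frechet_derivative f (at x)"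
    using differentiableI frechet_derivative_at by (blast, metis)
qed

text \<open>On an open set the values near a point determine the derivative there, so derivatives of
  equal functions are again equal on \<open>S\<close> and the induction can proceed.\<close>

lemma C_k_on_cong:
  assumes "open S" "\<And>x. x \<in> S \<Longrightarrow> f x = g x" "C_k_on k S f"
  shows "C_k_on k S g"
  using assms(2,3)
proof (induction k arbitrary: f g)
  case 0
  then show ?case using continuous_on_cong[of S S f g] by simp
next
  case (Suc k)
  have d: "f differentiable (at x)" if "x \<in> S" for x using Suc.prems(2) that by simp
  note c = has_derivative_frechet_cong[OF assms(1) _ Suc.prems(1) d]
  have "C_k_on k S (\<lambda>x. frechet_derivative g (at x) v)" for v
    using Suc.IH[of "\<lambda>x. frechet_derivative f (at x) v" "\<lambda>x. frechet_derivative g (at x) v"]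
      Suc.prems(2) c(2) by simp
  then show ?case using c(1) by simp
qed

text \<open>Lets the derivative be supplied as an explicit formula \<open>f'\<close> instead of the
  chosen \<open>frechet_derivative\<close>; uniqueness of derivatives identifies the two on
  \<open>S\<close>.\<close>

lemma C_k_on_SucI:
  assumes "open S" "\<And>x. x \<in> S \<Longrightarrow> (f has_derivative f' x) (at x)"
    "\<And>v. C_k_on k S (\<lambda>x. f' x v)"
  shows "C_k_on (Suc k) S f"
proof -
  have "frechet_derivative f (at x) = f' x" if "x \<in> S" for x
    using assms(2)[OF that] frechet_derivative_at by metis
  then have "C_k_on k S (\<lambda>x. frechet_derivative f (at x) v)" for v
    using C_k_on_cong[OF assms(1) _ assms(3)] by simp
  then show ?thesis using differentiableI[OF assms(2)] by simp
qed

lemma C_k_on_SucD: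
  assumes "C_k_on (Suc k) S f"
  shows "\<And>x. x \<in> S \<Longrightarrow> (f has_derivative frechet_derivative f (at x)) (at x)"
    "\<And>v. C_k_on k S (\<lambda>x. frechet_derivative f (at x) v)"
  using assms frechet_derivative_works by auto

lemma C_k_on_lower: "C_k_on (Suc k) S f \<Longrightarrow> C_k_on k S f"
proof (induction k arbitrary: f)
  case 0
  then show ?case
    by (auto intro!: continuous_at_imp_continuous_on differentiable_imp_continuous_within)
next
  case (Suc k)
  then show ?case by simp
qed

lemma C_k_on_continuous: "C_k_on k S f \<Longrightarrow> continuous_on S f"
proof (induction k)
  case (Suc k)
  show ?case by (rule Suc.IH[OF C_k_on_lower[OF Suc.prems]])
qed simp

text \<open>Serves functions that are given by different formulas, or through different charts, near
  different points.\<close>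

lemma C_k_on_local:
  assumes "\<And>x. x \<in> S \<Longrightarrow> \<exists>T. open T \<and> x \<in> T \<and> C_k_on k T f"
  shows "C_k_on k S f"
  using assms
proof (induction k arbitrary: f)
  case 0
  have "continuous_on S f"
    by (rule continuous_at_imp_continuous_on)
      (use 0 in \<open>fastforce simp: continuous_on_eq_continuous_at\<close>)
  then show ?case by simp
next
  case (Suc k)
  have "C_k_on k S (\<lambda>x. frechet_derivative f (at x) v)" for v
    by (rule Suc.IH) (use Suc.prems in fastforce)
  moreover have "f differentiable (at x)" if "x \<in> S" for x
    using Suc.prems[OF that] by auto
  ultimately show ?case by simp
qed

lemma C_k_on_subset: "C_k_on k T f \<Longrightarrow> S \<subseteq> T \<Longrightarrow> C_k_on k S f"
  by (induction k arbitrary: f) (auto intro: continuous_on_subset)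

lemma C_k_on_const: "open S \<Longrightarrow> C_k_on k S (\<lambda>x. c)"
proof (induction k arbitrary: c)
  case (Suc k)
  then show ?case
    by (intro C_k_on_SucI[where f' = "\<lambda>x v. 0"]) auto
qed simp

lemma C_k_on_bounded_linear:
  assumes "open S" "bounded_linear f"
  shows "C_k_on k S f"
proof (cases k)
  case 0
  then show ?thesis using assms by (simp add: linear_continuous_on)
next
  case (Suc m)
  show ?thesis unfolding Suc
    by (rule C_k_on_SucI[where f' = "\<lambda>x. f"])
      (use assms C_k_on_const bounded_linear_imp_has_derivative in auto)
qed

lemma C_k_on_add:
  assumes "open S"
  shows "C_k_on k S f \<Longrightarrow> C_k_on k S g \<Longrightarrow> C_k_on k S (\<lambda>x. f x + g x)"
proof (induction k arbitrary: f g)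
  case 0
  then show ?case by (simp add: continuous_on_add)
next
  case (Suc k)
  note D = C_k_on_SucD[OF Suc.prems(1)] C_k_on_SucD[OF Suc.prems(2)]
  show ?case
    by (rule C_k_on_SucI[OF assms, where
          f' = "\<lambda>x v. frechet_derivative f (at x) v + frechet_derivative g (at x) v"])
      (use D Suc.IH in \<open>auto intro!: has_derivative_add\<close>)
qed

lemma C_k_on_sum:
  assumes "open S" "\<And>i. i \<in> I \<Longrightarrow> C_k_on k S (f i)"
  shows "C_k_on k S (\<lambda>x. \<Sum>i\<in>I. f i x)"
  using assms(2)
  by (induction I rule: infinite_finite_induct)
    (auto intro: C_k_on_const C_k_on_add assms(1))

text \<open>The Leibniz rule turns the derivative into a sum of products of the same kind, in which
  the undifferentiated factor is used at order k by \<open>C_k_on_lower\<close>. One induction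
  covers multiplication, inner product and scaling.\<close>

lemma (in bounded_bilinear) C_k_on_prod:
  assumes "open S"
  shows "C_k_on k S f \<Longrightarrow> C_k_on k S g \<Longrightarrow> C_k_on k S (\<lambda>x. prod (f x) (g x))"
proof (induction k arbitrary: f g)
  case 0
  then show ?case by (simp add: continuous_on)
next
  case (Suc k)
  note D = C_k_on_SucD[OF Suc.prems(1)] C_k_on_SucD[OF Suc.prems(2)]
  have "C_k_on k S (\<lambda>x. prod (f x) (frechet_derivative g (at x) v)
      + prod (frechet_derivative f (at x) v) (g x))" for v
    by (intro C_k_on_add assms Suc.IH Suc.prems[THEN C_k_on_lower] D)
  then show ?case
    by (intro C_k_on_SucI[OF assms, where f' = "\<lambda>x v. prod (f x) (frechet_derivative g (at x) v)
      + prod (frechet_derivative f (at x) v) (g x)"] FDERIV D)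
qed

lemma C_k_on_compose:
  fixes g :: "'a::real_normed_vector \<Rightarrow> 'b::euclidean_space"
    and f :: "'b \<Rightarrow> 'c::real_normed_vector"
  assumes "open S" "open T" "g ` S \<subseteq> T"
  shows "C_k_on k T f \<Longrightarrow> C_k_on k S g \<Longrightarrow> C_k_on k S (\<lambda>x. f (g x))"
proof (induction k arbitrary: f)
  case 0
  then show ?case
    using assms(3) continuous_on_compose2 by (metis C_k_on.simps(1))
next
  case (Suc k)
  note D = C_k_on_SucD[OF Suc.prems(1)] C_k_on_SucD[OF Suc.prems(2)]
  have gk: "C_k_on k S g" using C_k_on_lower Suc.prems by blast
  \<comment> \<open>The definition of \<open>C_k_on\<close> controls derivatives in a fixed
    direction only, whereas the chain rule differentiates \<open>f\<close> in the direction Dg(x)v,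
    which varies with x. Expanding that direction in \<open>Basis\<close> leaves fixed directions
    with scalar coefficients of class C^k.\<close>
  let ?f' = "\<lambda>x v. \<Sum>b\<in>Basis. (frechet_derivative g (at x) v \<bullet> b) *\<^sub>R frechet_derivative f (at (g x)) b"
  show ?case
  proof (rule C_k_on_SucI[OF assms(1), where f' = ?f'])
    fix x assume x: "x \<in> S"
    then have fd: "(f has_derivative frechet_derivative f (at (g x))) (at (g x))"
      using D(1) assms(3) by auto
    have der: "((\<lambda>x. f (g x)) has_derivative
        (\<lambda>v. frechet_derivative f (at (g x)) (frechet_derivative g (at x) v))) (at x)"
      using diff_chain_at[OF D(3)[OF x] fd] by (simp add: o_def)
    have eq: "frechet_derivative f (at (g x)) u
        = (\<Sum>b\<in>Basis. (u \<bullet> b) *\<^sub>R frechet_derivative f (at (g x)) b)" for u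
    proof -
      interpret bounded_linear "frechet_derivative f (at (g x))"
        using fd has_derivative_bounded_linear by blast
      show ?thesis
        by (subst euclidean_representation[of u, symmetric]) (simp only: sum scale)
    qed
    show "((\<lambda>x. f (g x)) has_derivative ?f' x) (at x)"
      by (rule has_derivative_eq_rhs[OF der]) (intro ext eq)
  next
    fix v
    have "C_k_on k S (\<lambda>x. frechet_derivative g (at x) v \<bullet> b)" for b
      using D(4) bounded_bilinear.C_k_on_prod[OF bounded_bilinear_inner assms(1)]
        C_k_on_const[OF assms(1)] by blast
    moreover have "C_k_on k S (\<lambda>x. frechet_derivative f (at (g x)) b)" for b
      by (rule Suc.IH[OF D(2) gk])
    ultimately show "C_k_on k S (\<lambda>x. ?f' x v)"
      using bounded_bilinear.C_k_on_prod[OF bounded_bilinear_scaleR assms(1)]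
      by (intro C_k_on_sum[OF assms(1)]) blast
  qed
qed

section \<open>Closure properties of smooth maps\<close>

lemma smooth_on_cong:
  "open S \<Longrightarrow> (\<And>x. x \<in> S \<Longrightarrow> f x = g x) \<Longrightarrow> smooth_on S f \<Longrightarrow> smooth_on S g"
  unfolding smooth_on_def using C_k_on_cong by blast

lemma smooth_on_subset: "smooth_on T f \<Longrightarrow> S \<subseteq> T \<Longrightarrow> smooth_on S f"
  unfolding smooth_on_def using C_k_on_subset by blast

lemma smooth_on_local:
  "(\<And>x. x \<in> S \<Longrightarrow> \<exists>T. open T \<and> x \<in> T \<and> smooth_on T f) \<Longrightarrow> smooth_on S f"
  unfolding smooth_on_def by (meson C_k_on_local)

lemma smooth_on_const: "open S \<Longrightarrow> smooth_on S (\<lambda>x. c)"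
  unfolding smooth_on_def using C_k_on_const by blast

lemma smooth_on_bounded_linear: "open S \<Longrightarrow> bounded_linear f \<Longrightarrow> smooth_on S f"
  unfolding smooth_on_def using C_k_on_bounded_linear by blast

lemma smooth_on_add:
  "open S \<Longrightarrow> smooth_on S f \<Longrightarrow> smooth_on S g \<Longrightarrow> smooth_on S (\<lambda>x. f x + g x)"
  unfolding smooth_on_def using C_k_on_add by blast

lemma smooth_on_mult:
  fixes f g :: "_ \<Rightarrow> real"
  shows "open S \<Longrightarrow> smooth_on S f \<Longrightarrow> smooth_on S g \<Longrightarrow> smooth_on S (\<lambda>x. f x * g x)"
  unfolding smooth_on_def using bounded_bilinear.C_k_on_prod[OF bounded_bilinear_mult] by blast

lemma smooth_on_inner:
  "open S \<Longrightarrow> smooth_on S f \<Longrightarrow> smooth_on S g \<Longrightarrow> smooth_on S (\<lambda>x. f x \<bullet> g x)"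
  unfolding smooth_on_def using bounded_bilinear.C_k_on_prod[OF bounded_bilinear_inner] by blast

lemma smooth_on_compose:
  fixes g :: "'a::real_normed_vector \<Rightarrow> 'b::euclidean_space"
  shows "open S \<Longrightarrow> open T \<Longrightarrow> g ` S \<subseteq> T \<Longrightarrow> smooth_on T f \<Longrightarrow> smooth_on S g
    \<Longrightarrow> smooth_on S (\<lambda>x. f (g x))"
  unfolding smooth_on_def using C_k_on_compose by blast

lemma smooth_on_frechet:
  assumes "smooth_on S f"
  shows "x \<in> S \<Longrightarrow> (f has_derivative frechet_derivative f (at x)) (at x)"
    "smooth_on S (\<lambda>x. frechet_derivative f (at x) v)"
  using assms C_k_on_SucD unfolding smooth_on_def by blast+

lemma smooth_on_continuous: "smooth_on S f \<Longrightarrow> continuous_on S f"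
  unfolding smooth_on_def using C_k_on_continuous by blast

section \<open>Bump functions and Hadamard's lemma\<close>

text \<open>For n = 0 this is the classical flat function exp(-1/t). The extra factors 1/t make the
  family closed, up to linear combinations, under differentiation.\<close>

definition flat_exp :: "nat \<Rightarrow> real \<Rightarrow> real" where
  "flat_exp n t = (if t > 0 then exp (- inverse t) * inverse t ^ n else 0)"

text \<open>From the right, substitute s = 1/t: the exponential dominates every power of s.\<close>

lemma flat_exp_tendsto_0: "(flat_exp n \<longlongrightarrow> 0) (at 0)"
proof (rule filterlim_split_at)
  have "eventually (\<lambda>t. flat_exp n t = 0) (at_left 0)"
    by (auto simp: eventually_at_filter flat_exp_def)
  then show "(flat_exp n \<longlongrightarrow> 0) (at_left 0)"
    by (rule tendsto_eventually)
  have "((\<lambda>t. inverse t ^ n / exp (inverse t)) \<longlongrightarrow> (0::real)) (at_right 0)"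
    using filterlim_compose[OF tendsto_power_div_exp_0 filterlim_inverse_at_top_right] .
  moreover have "eventually (\<lambda>t. inverse t ^ n / exp (inverse t) = flat_exp n t) (at_right 0)"
    by (auto simp: eventually_at_filter flat_exp_def exp_minus field_simps)
  ultimately show "(flat_exp n \<longlongrightarrow> 0) (at_right 0)"
    using tendsto_cong by fast
qed

lemma flat_exp_deriv:
  "(flat_exp n has_real_derivative flat_exp (n + 2) t - n * flat_exp (n + 1) t) (at t)"
proof -
  consider "t > 0" | "t < 0" | "t = 0" by linarith
  then show ?thesis
  proof cases
    case 1
    have pow: "t ^ m = t * t ^ (m - Suc 0)" if "m \<noteq> 0" for m
      using that by (cases m) auto
    have "((\<lambda>t. exp (- inverse t) * inverse t ^ n) has_real_derivative
        flat_exp (n + 2) t - n * flat_exp (n + 1) t) (at t)"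
      using 1
      by (cases n)
        (auto intro!: derivative_eq_intros pow simp: flat_exp_def field_simps power2_eq_square)
    then show ?thesis
      by (rule has_field_derivative_transform_within_open[where S = "{0<..}"])
        (use 1 in \<open>auto simp: flat_exp_def\<close>)
  next
    case 2
    have "((\<lambda>t. 0) has_real_derivative flat_exp (n + 2) t - n * flat_exp (n + 1) t) (at t)"
      using 2 by (auto simp: flat_exp_def)
    then show ?thesis
      by (rule has_field_derivative_transform_within_open[where S = "{..<0}"])
        (use 2 in \<open>auto simp: flat_exp_def\<close>)
  next
    case 3
    \<comment> \<open>At the origin the difference quotient is the next member of the family, so its
      limit is known. The identity also holds at h = 0, where division by zero yields 0.\<close>
    have quot: "(flat_exp n h - flat_exp n 0) / (h - 0) = flat_exp (Suc n) h" for h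
      by (auto simp: flat_exp_def field_simps)
    have "flat_exp m 0 = 0" for m by (simp add: flat_exp_def)
    then show ?thesis
      using flat_exp_tendsto_0[of "Suc n"] unfolding 3 has_field_derivative_iff quot by simp
  qed
qed

text \<open>Each derivative is a combination of later members of the family, so the induction on the
  order ranges over all n at once.\<close>

lemma smooth_on_flat_exp: "smooth_on UNIV (flat_exp n)"
proof -
  have "C_k_on k UNIV (flat_exp n)" for k
  proof (induction k arbitrary: n)
    case 0
    show ?case
      by (auto intro!: continuous_at_imp_continuous_on DERIV_isCont flat_exp_deriv)
  next
    case (Suc k)
    show ?case
    proof (rule C_k_on_SucI)
      show "(flat_exp n has_derivative (*) (flat_exp (n + 2) t + (- n) * flat_exp (n + 1) t)) (at t)"
        for t
        using flat_exp_deriv[of n t] by (simp add: has_field_derivative_def)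
      show "C_k_on k UNIV (\<lambda>t. (flat_exp (n + 2) t + (- n) * flat_exp (n + 1) t) * v)" for v :: real
        by (intro C_k_on_add bounded_bilinear.C_k_on_prod[OF bounded_bilinear_mult] C_k_on_const
            Suc.IH open_UNIV)
    qed simp
  qed
  then show ?thesis unfolding smooth_on_def by blast
qed

text \<open>Compose \<open>flat_exp 0\<close> with r^2 - |x - x0|^2, which is nonpositive outside
  the ball, and divide by the positive value at the centre.\<close>

lemma smooth_bump:
  fixes x0 :: "'e::euclidean_space"
  assumes "r > 0"
  obtains \<beta> :: "'e \<Rightarrow> real"
  where "smooth_on UNIV \<beta>" "\<beta> x0 = 1" "\<And>x. x \<notin> cball x0 r \<Longrightarrow> \<beta> x = 0"
proof
  let ?q = "\<lambda>x. r\<^sup>2 - (x - x0) \<bullet> (x - x0)"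
  let ?\<beta> = "\<lambda>x. inverse (flat_exp 0 (r\<^sup>2)) * flat_exp 0 (?q x)"
  have id: "smooth_on UNIV (\<lambda>x::'e. x + - x0)"
    by (intro smooth_on_add smooth_on_const smooth_on_bounded_linear bounded_linear_ident open_UNIV)
  have "smooth_on UNIV (\<lambda>x. r\<^sup>2 + (-1) * ((x + - x0) \<bullet> (x + - x0)))"
    by (intro smooth_on_add smooth_on_mult smooth_on_inner smooth_on_const open_UNIV id)
  then have "smooth_on UNIV ?q" by simp
  then show "smooth_on UNIV ?\<beta>"
    by (intro smooth_on_mult smooth_on_const smooth_on_compose[OF _ _ _ smooth_on_flat_exp]) auto
  show "?\<beta> x0 = 1" using assms by (simp add: flat_exp_def)
  show "?\<beta> x = 0" if "x \<notin> cball x0 r" for x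
  proof -
    have "r < norm (x - x0)" using that by (simp add: dist_norm norm_minus_commute)
    then have "r\<^sup>2 \<le> (x - x0) \<bullet> (x - x0)"
      using assms unfolding power2_norm_eq_inner[symmetric] by (intro power_mono) auto
    then show ?thesis by (simp add: flat_exp_def)
  qed
qed

section \<open>Integrals along rays and Hadamard's lemma\<close>

lemma segment_in_ball:
  fixes x0 :: "'e::real_normed_vector"
  assumes "y \<in> ball x0 R" "t \<in> {0..1}"
  shows "x0 + t *\<^sub>R (y - x0) \<in> ball x0 R"
proof -
  have "t * norm (y - x0) \<le> 1 * norm (y - x0)" using assms(2) by (intro mult_right_mono) auto
  then show ?thesis using assms by (simp add: dist_norm norm_minus_commute)
qed

text \<open>Differentiating under the integral sign in y brings out one factor t each time; the
  weight t^j absorbs these factors, so the class of such integrals is stable under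
  differentiation.\<close>

definition ray_integral :: "'e::euclidean_space \<Rightarrow> nat \<Rightarrow> ('e \<Rightarrow> real) \<Rightarrow> 'e \<Rightarrow> real" where
  "ray_integral x0 j h y = integral (cbox 0 1) (\<lambda>t. t ^ j * h (x0 + t *\<^sub>R (y - x0)))"

lemma continuous_on_ray:
  fixes x0 :: "'e::euclidean_space" and h :: "'e \<Rightarrow> real"
  assumes "continuous_on (ball x0 R) h"
  shows "continuous_on (ball x0 R \<times> cbox 0 1) (\<lambda>(y, t). t ^ j * h (x0 + t *\<^sub>R (y - x0)))"
proof -
  have "continuous_on (ball x0 R \<times> cbox 0 1) (\<lambda>z. h (x0 + snd z *\<^sub>R (fst z - x0)))"
    by (rule continuous_on_compose2[OF assms])
      (use segment_in_ball in \<open>force intro!: continuous_intros\<close>)+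
  then show ?thesis
    unfolding case_prod_unfold by (intro continuous_intros)
qed

lemma integrable_ray:
  fixes x0 :: "'e::euclidean_space" and h :: "'e \<Rightarrow> real"
  assumes "continuous_on (ball x0 R) h" "y \<in> ball x0 R"
  shows "(\<lambda>t. t ^ j * h (x0 + t *\<^sub>R (y - x0))) integrable_on cbox 0 1"
proof (rule integrable_continuous)
  have "continuous_on (cbox 0 1) (\<lambda>t. case (y, t) of (y, t) \<Rightarrow> t ^ j * h (x0 + t *\<^sub>R (y - x0)))"
    by (rule continuous_on_compose2[OF continuous_on_ray[OF assms(1)]])
      (use assms(2) in \<open>auto intro!: continuous_intros\<close>)
  then show "continuous_on (cbox 0 1) (\<lambda>t. t ^ j * h (x0 + t *\<^sub>R (y - x0)))" by simp
qed

lemma has_derivative_ray_integral: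
  fixes x0 :: "'e::euclidean_space" and h :: "'e \<Rightarrow> real"
  assumes h: "smooth_on (ball x0 R) h" and y: "y \<in> ball x0 R"
  shows "(ray_integral x0 j h has_derivative
    (\<lambda>v. ray_integral x0 (Suc j) (\<lambda>x. frechet_derivative h (at x) v) y)) (at y)"
proof -
  let ?D = "\<lambda>x. frechet_derivative h (at x)"
  \<comment> \<open>The derivative of the integrand as a bounded linear map, the form in which
    \<open>leibniz_rule\<close> integrates it. Written in the basis, its joint continuity reduces to
    that of scalar coefficients.\<close>
  let ?fx = "\<lambda>y t. \<Sum>b\<in>Basis. (t ^ Suc j * ?D (x0 + t *\<^sub>R (y - x0)) b) *\<^sub>R blinfun_inner_left b"
  have lin: "?D x v = (\<Sum>b\<in>Basis. ?D x b * (v \<bullet> b))" if "x \<in> ball x0 R" for x v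
  proof -
    interpret bounded_linear "?D x"
      using smooth_on_frechet(1)[OF h that] has_derivative_bounded_linear by blast
    have "?D x v = ?D x (\<Sum>b\<in>Basis. (v \<bullet> b) *\<^sub>R b)" by (simp add: euclidean_representation)
    then show ?thesis by (simp add: sum scale mult.commute)
  qed
  have app: "blinfun_apply (?fx y t) v = t ^ Suc j * ?D (x0 + t *\<^sub>R (y - x0)) v"
    if "y \<in> ball x0 R" "t \<in> cbox 0 1" for y t v
  proof -
    have "blinfun_apply (?fx y t) v = (\<Sum>b\<in>Basis. t ^ Suc j * ?D (x0 + t *\<^sub>R (y - x0)) b * (v \<bullet> b))"
      by (simp add: blinfun.sum_left blinfun.scaleR_left)
    also have "\<dots> = t ^ Suc j * (\<Sum>b\<in>Basis. ?D (x0 + t *\<^sub>R (y - x0)) b * (v \<bullet> b))"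
      by (simp add: sum_distrib_left mult.assoc)
    finally show ?thesis using lin segment_in_ball[OF that(1)] that(2) by simp
  qed
  have cont: "continuous_on (ball x0 R \<times> cbox 0 1) (\<lambda>(y, t). ?fx y t)"
  proof -
    have "continuous_on (ball x0 R \<times> cbox 0 1) (\<lambda>z. snd z ^ Suc j * ?D (x0 + snd z *\<^sub>R (fst z - x0)) b)" for b
      using continuous_on_ray[OF smooth_on_continuous[OF smooth_on_frechet(2)[OF h]]]
      unfolding case_prod_unfold by blast
    then show ?thesis unfolding case_prod_unfold
      by (intro continuous_on_sum continuous_on_scaleR continuous_on_const)
  qed
  have der: "((\<lambda>y. t ^ j * h (x0 + t *\<^sub>R (y - x0))) has_derivative blinfun_apply (?fx y t))
      (at y within ball x0 R)" if "y \<in> ball x0 R" "t \<in> cbox 0 1" for y t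
  proof -
    have "x0 + t *\<^sub>R (y - x0) \<in> ball x0 R" using segment_in_ball that by simp
    note hd = smooth_on_frechet(1)[OF h this]
    interpret bounded_linear "?D (x0 + t *\<^sub>R (y - x0))"
      using hd has_derivative_bounded_linear by blast
    have "((\<lambda>y. x0 + t *\<^sub>R (y - x0)) has_derivative (\<lambda>v. t *\<^sub>R v)) (at y)"
      by (auto intro!: derivative_eq_intros)
    from has_derivative_compose[OF this hd]
    have "((\<lambda>y. t ^ j * h (x0 + t *\<^sub>R (y - x0))) has_derivative
        (\<lambda>v. t ^ j * ?D (x0 + t *\<^sub>R (y - x0)) (t *\<^sub>R v))) (at y)"
      by (rule has_derivative_mult_right)
    moreover have "(\<lambda>v. t ^ j * ?D (x0 + t *\<^sub>R (y - x0)) (t *\<^sub>R v)) = blinfun_apply (?fx y t)"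
      by (rule ext) (simp only: app[OF that], simp add: scale mult_ac)
    ultimately show ?thesis by (metis has_derivative_at_withinI)
  qed
  have int_der: "((\<lambda>y. integral (cbox 0 1) (\<lambda>t. t ^ j * h (x0 + t *\<^sub>R (y - x0)))) has_derivative
      integral (cbox 0 1) (?fx y)) (at y within ball x0 R)"
    by (rule leibniz_rule[OF der integrable_ray[OF smooth_on_continuous[OF h]] cont y])
      auto
  have int_app: "blinfun_apply (integral (cbox 0 1) (?fx y)) v =
      ray_integral x0 (Suc j) (\<lambda>x. ?D x v) y" for v
  proof -
    have "?fx y integrable_on cbox 0 1"
    proof (rule integrable_continuous)
      have "continuous_on (cbox 0 1) (\<lambda>t. case (y, t) of (y, t) \<Rightarrow> ?fx y t)"
        by (rule continuous_on_compose2[OF cont]) (use y in \<open>auto intro!: continuous_intros\<close>)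
      then show "continuous_on (cbox 0 1) (?fx y)" by simp
    qed
    then have "blinfun_apply (integral (cbox 0 1) (?fx y)) v
        = integral (cbox 0 1) (\<lambda>t. blinfun_apply (?fx y t) v)"
      by (rule blinfun_apply_integral)
    also have "\<dots> = integral (cbox 0 1) (\<lambda>t. t ^ Suc j * ?D (x0 + t *\<^sub>R (y - x0)) v)"
      by (rule integral_cong) (rule app[OF y])
    finally show ?thesis unfolding ray_integral_def .
  qed
  have "((\<lambda>y. integral (cbox 0 1) (\<lambda>t. t ^ j * h (x0 + t *\<^sub>R (y - x0)))) has_derivative
      (\<lambda>v. ray_integral x0 (Suc j) (\<lambda>x. ?D x v) y)) (at y within ball x0 R)"
    by (rule has_derivative_eq_rhs[OF int_der]) (intro ext int_app)
  then show ?thesis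
    using at_within_open[OF y open_ball] unfolding ray_integral_def[abs_def] by simp
qed

text \<open>The derivative is again a ray integral, with exponent j + 1 and with a directional
  derivative of \<open>h\<close> as integrand; hence the induction keeps \<open>h\<close> and
  \<open>j\<close> arbitrary.\<close>

lemma smooth_on_ray_integral:
  fixes h :: "'e::euclidean_space \<Rightarrow> real"
  assumes "smooth_on (ball x0 R) h"
  shows "smooth_on (ball x0 R) (ray_integral x0 j h)"
proof -
  have "C_k_on k (ball x0 R) (ray_integral x0 j h)" for k
    using assms
  proof (induction k arbitrary: h j)
    case 0
    have "isCont (ray_integral x0 j h) y" if "y \<in> ball x0 R" for y
      using has_derivative_continuous[OF has_derivative_ray_integral[OF 0 that]] .
    then show ?case by (simp add: continuous_at_imp_continuous_on)
  next
    case (Suc k)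
    show ?case
      by (rule C_k_on_SucI[OF open_ball has_derivative_ray_integral[OF Suc.prems]])
        (auto intro: Suc.IH smooth_on_frechet(2) Suc.prems)
  qed
  then show ?thesis unfolding smooth_on_def by blast
qed

text \<open>Hadamard's lemma: integrate the derivative of \<open>f\<close> along the segment from
  \<open>x0\<close> to y. The coefficient \<open>q b\<close> is the integral of the derivative in
  direction \<open>b\<close>, whose integrand is constant in t when y = \<open>x0\<close>.\<close>

lemma smooth_on_first_order_remainder:
  fixes f :: "'e::euclidean_space \<Rightarrow> real"
  assumes f: "smooth_on (ball x0 R) f" and "R > 0"
  obtains q where "\<And>b. smooth_on (ball x0 R) (q b)" "\<And>b. q b x0 = frechet_derivative f (at x0) b"
    "\<And>y. y \<in> ball x0 R \<Longrightarrow> f y = f x0 + (\<Sum>b\<in>Basis. ((y - x0) \<bullet> b) * q b y)"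
proof
  let ?D = "\<lambda>x. frechet_derivative f (at x)"
  let ?q = "\<lambda>b. ray_integral x0 0 (\<lambda>x. ?D x b)"
  show "smooth_on (ball x0 R) (?q b)" for b
    by (intro smooth_on_ray_integral smooth_on_frechet f)
  show "?q b x0 = ?D x0 b" for b
    by (simp add: ray_integral_def)
  fix y assume y: "y \<in> ball x0 R"
  have lin: "?D x (y - x0) = (\<Sum>b\<in>Basis. ((y - x0) \<bullet> b) * ?D x b)" if "x \<in> ball x0 R" for x
  proof -
    interpret bounded_linear "?D x"
      using smooth_on_frechet(1)[OF f that] has_derivative_bounded_linear by blast
    have "?D x (y - x0) = ?D x (\<Sum>b\<in>Basis. ((y - x0) \<bullet> b) *\<^sub>R b)"
      by (simp only: euclidean_representation)
    then show ?thesis by (simp only: sum scale real_scaleR_def)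
  qed
  have "((\<lambda>t. ?D (x0 + t *\<^sub>R (y - x0)) (y - x0)) has_integral
      f (x0 + 1 *\<^sub>R (y - x0)) - f (x0 + 0 *\<^sub>R (y - x0))) {0..1}"
  proof (rule fundamental_theorem_of_calculus)
    fix t :: real assume t: "t \<in> {0..1}"
    note fd = smooth_on_frechet(1)[OF f segment_in_ball[OF y t]]
    interpret bounded_linear "?D (x0 + t *\<^sub>R (y - x0))"
      using fd has_derivative_bounded_linear by blast
    have "((\<lambda>t. x0 + t *\<^sub>R (y - x0)) has_derivative (\<lambda>s. s *\<^sub>R (y - x0))) (at t)"
      by (auto intro!: derivative_eq_intros)
    from has_derivative_compose[OF this fd]
    have "((\<lambda>t. f (x0 + t *\<^sub>R (y - x0))) has_vector_derivative ?D (x0 + t *\<^sub>R (y - x0)) (y - x0)) (at t)"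
      unfolding has_vector_derivative_def scale .
    then show "((\<lambda>t. f (x0 + t *\<^sub>R (y - x0))) has_vector_derivative ?D (x0 + t *\<^sub>R (y - x0)) (y - x0))
        (at t within {0..1})"
      by (rule has_vector_derivative_at_within)
  qed simp
  then have "f y - f x0 = integral (cbox 0 1) (\<lambda>t. ?D (x0 + t *\<^sub>R (y - x0)) (y - x0))"
    by (simp add: integral_unique)
  also have "\<dots> = integral (cbox 0 1)
      (\<lambda>t. \<Sum>b\<in>Basis. ((y - x0) \<bullet> b) * (t ^ 0 * ?D (x0 + t *\<^sub>R (y - x0)) b))"
    using lin segment_in_ball[OF y] by (intro integral_cong) simp
  also have "\<dots> = (\<Sum>b\<in>Basis. ((y - x0) \<bullet> b) * ?q b y)"
    unfolding ray_integral_def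
    by (subst integral_sum)
      (use integrable_ray[OF smooth_on_continuous[OF smooth_on_frechet(2)[OF f]] y, of 0]
        in \<open>auto intro!: integrable_on_mult_right\<close>)
  finally show "f y = f x0 + (\<Sum>b\<in>Basis. ((y - x0) \<bullet> b) * ?q b y)" by simp
qed

section \<open>Derivations in a chart\<close>

lemma is_chartD:
  assumes "is_chart (U, \<phi>)"
  shows "open U" "open (\<phi> ` U)" "continuous_on U \<phi>" "continuous_on (\<phi> ` U) (inv_into U \<phi>)"
    "\<And>p. p \<in> U \<Longrightarrow> inv_into U \<phi> (\<phi> p) = p"
  using assms unfolding is_chart_def homeomorphism_def by auto

lemma chart_image_open:
  assumes "is_chart (U, \<phi>)" "open W"
  shows "open (\<phi> ` (U \<inter> W))"
proof -
  have "\<phi> ` (U \<inter> W) = \<phi> ` U \<inter> inv_into U \<phi> -` W"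
    using is_chartD(5)[OF assms(1)] by (auto intro: rev_image_eqI)
  then show ?thesis
    using continuous_open_preimage[OF is_chartD(4,2)[OF assms(1)] assms(2)] by simp
qed

lemma chart_vimage_open:
  assumes "is_chart (U, \<phi>)" "open W"
  shows "open (U \<inter> \<phi> -` W)"
  using continuous_open_preimage[OF is_chartD(3,1)[OF assms(1)] assms(2)] .

lemma smooth_manifold_chart: "smooth_manifold A \<Longrightarrow> (U, \<phi>) \<in> A \<Longrightarrow> is_chart (U, \<phi>)"
  unfolding smooth_manifold_def by blast

lemma smooth_manifold_covers:
  assumes "smooth_manifold A"
  obtains U \<phi> where "(U, \<phi>) \<in> A" "p \<in> U"
proof -
  have "p \<in> \<Union>(fst ` A)" using assms unfolding smooth_manifold_def by simp
  then show thesis using that by auto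
qed

section \<open>The algebra of smooth functions\<close>

lemma smooth_functions_const:
  assumes "smooth_manifold A"
  shows "(\<lambda>p. c) \<in> smooth_functions A"
  using smooth_on_const is_chartD(2) smooth_manifold_chart[OF assms]
  unfolding smooth_functions_def o_def by blast

lemma smooth_functions_add:
  assumes "smooth_manifold A" "f \<in> smooth_functions A" "h \<in> smooth_functions A"
  shows "(\<lambda>p. f p + h p) \<in> smooth_functions A"
  using smooth_on_add is_chartD(2) smooth_manifold_chart[OF assms(1)] assms(2,3)
  unfolding smooth_functions_def o_def by fast

lemma smooth_functions_mult:
  assumes "smooth_manifold A" "f \<in> smooth_functions A" "h \<in> smooth_functions A"
  shows "(\<lambda>p. f p * h p) \<in> smooth_functions A"
  using smooth_on_mult is_chartD(2) smooth_manifold_chart[OF assms(1)] assms(2,3)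
  unfolding smooth_functions_def o_def by fast

lemma smooth_functions_sum:
  assumes "smooth_manifold A" "\<And>i. i \<in> I \<Longrightarrow> f i \<in> smooth_functions A"
  shows "(\<lambda>p. \<Sum>i\<in>I. f i p) \<in> smooth_functions A"
  using assms(2)
  by (induction I rule: infinite_finite_induct)
    (auto intro: smooth_functions_const smooth_functions_add assms(1))

lemma smooth_functions_chart_has_derivative:
  assumes "f \<in> smooth_functions A" "(V, \<psi>) \<in> A" "p \<in> V"
  shows "(f \<circ> inv_into V \<psi> has_derivative frechet_derivative (f \<circ> inv_into V \<psi>) (at (\<psi> p))) (at (\<psi> p))"
  using assms smooth_on_frechet(1)[of "\<psi> ` V"] unfolding smooth_functions_def by blast

section \<open>Derivations at a point\<close>

lemma tangent_spaceD:
  assumes "v \<in> tangent_space A p"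
  shows "\<And>f. f \<notin> smooth_functions A \<Longrightarrow> v f = 0"
    "\<And>f h a b. f \<in> smooth_functions A \<Longrightarrow> h \<in> smooth_functions A \<Longrightarrow>
      v (\<lambda>x. a * f x + b * h x) = a * v f + b * v h"
    "\<And>f h. f \<in> smooth_functions A \<Longrightarrow> h \<in> smooth_functions A \<Longrightarrow>
      v (\<lambda>x. f x * h x) = v f * h p + f p * v h"
  using assms unfolding tangent_space_def by simp_all

text \<open>The Leibniz rule for 1 * 1 gives v 1 = 2 v 1, so v 1 = 0; scale by linearity.\<close>

lemma tangent_space_const:
  assumes "smooth_manifold A" "v \<in> tangent_space A p"
  shows "v (\<lambda>x. c) = 0"
proof -
  note one = smooth_functions_const[OF assms(1), of 1]
  have "v (\<lambda>x. 1) = 0" using tangent_spaceD(3)[OF assms(2) one one] by simp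
  then show ?thesis using tangent_spaceD(2)[OF assms(2) one one, of c 0] by simp
qed

lemma tangent_space_sum:
  assumes "smooth_manifold A" "v \<in> tangent_space A p" "\<And>i. i \<in> I \<Longrightarrow> f i \<in> smooth_functions A"
  shows "v (\<lambda>x. \<Sum>i\<in>I. f i x) = (\<Sum>i\<in>I. v (f i))"
  using assms(3)
proof (induction I rule: infinite_finite_induct)
  case (insert i I)
  have "v (\<lambda>x. 1 * f i x + 1 * (\<Sum>i\<in>I. f i x)) = 1 * v (f i) + 1 * v (\<lambda>x. \<Sum>i\<in>I. f i x)"
    by (rule tangent_spaceD(2)[OF assms(2)]) (auto intro: insert.prems smooth_functions_sum assms(1))
  then show ?case using insert by simp
qed (use tangent_space_const[OF assms(1,2)] in auto)

lemma lincomb_in_tangent_space: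
  assumes "u \<in> tangent_space A p" "v \<in> tangent_space A p"
  shows "lincomb a u b v \<in> tangent_space A p"
  using tangent_spaceD[OF assms(1)] tangent_spaceD[OF assms(2)]
  unfolding lincomb_def tangent_space_def by (simp add: algebra_simps)

section \<open>Extension by zero and tangent vectors of a chart\<close>

definition chart_extend :: "'a set \<Rightarrow> ('a \<Rightarrow> 'e) \<Rightarrow> 'e set \<Rightarrow> ('e \<Rightarrow> real) \<Rightarrow> 'a \<Rightarrow> real" where
  "chart_extend V \<psi> W k p = (if p \<in> V \<and> \<psi> p \<in> W then k (\<psi> p) else 0)"

text \<open>The extension vanishes off the image of \<open>K\<close> in the manifold, which is
  compact and therefore closed in a Hausdorff space. The manifold is thus covered by two open sets:
  where the coordinates lie in \<open>W\<close>, the function is \<open>k\<close> composed with a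
  transition map; off the compact set it is zero.\<close>

lemma chart_extend_smooth:
  fixes A :: "('a::{t2_space,second_countable_topology}, 'e::euclidean_space) chart set"
  assumes A: "smooth_manifold A" and V: "(V, \<psi>) \<in> A"
    and k: "smooth_on W k" and W: "open W" "W \<subseteq> \<psi> ` V"
    and K: "compact K" "K \<subseteq> W" "\<And>y. y \<in> W - K \<Longrightarrow> k y = 0"
  shows "chart_extend V \<psi> W k \<in> smooth_functions A"
  unfolding smooth_functions_def
proof (clarify)
  fix U \<phi> assume U: "(U, \<phi>) \<in> A"
  note cU = smooth_manifold_chart[OF A U] and cV = smooth_manifold_chart[OF A V]
  let ?L = "inv_into V \<psi> ` K"
  have "continuous_on K (inv_into V \<psi>)"
    using continuous_on_subset[OF is_chartD(4)[OF cV]] K(2) W(2) by blast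
  then have "compact ?L" using compact_continuous_image K(1) by blast
  then have L: "open (- ?L)" using compact_imp_closed by blast
  have L_sub: "q \<in> V \<and> \<psi> q \<in> W" if "q \<in> ?L" for q
    using that K(2) W(2) is_chartD(5)[OF cV] by fastforce
  have zero: "chart_extend V \<psi> W k q = 0" if "q \<notin> ?L" for q
    using that K(3) is_chartD(5)[OF cV, of q] unfolding chart_extend_def
    by (metis DiffI image_eqI)
  show "smooth_on (\<phi> ` U) (chart_extend V \<psi> W k \<circ> inv_into U \<phi>)"
  proof (rule smooth_on_local)
    fix x assume "x \<in> \<phi> ` U"
    then obtain p where p: "p \<in> U" "x = \<phi> p" by blast
    show "\<exists>T. open T \<and> x \<in> T \<and> smooth_on T (chart_extend V \<psi> W k \<circ> inv_into U \<phi>)"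
    proof (cases "p \<in> V \<and> \<psi> p \<in> W")
      case True
      let ?T = "\<phi> ` (U \<inter> (V \<inter> \<psi> -` W))"
      have oT: "open ?T" using chart_image_open[OF cU chart_vimage_open[OF cV W(1)]] .
      have "smooth_on (\<phi> ` (U \<inter> V)) (\<psi> \<circ> inv_into U \<phi>)"
        using A U V unfolding smooth_manifold_def by blast
      then have "smooth_on ?T (\<psi> \<circ> inv_into U \<phi>)" by (rule smooth_on_subset) blast
      moreover have "(\<psi> \<circ> inv_into U \<phi>) ` ?T \<subseteq> W" using is_chartD(5)[OF cU] by auto
      ultimately have "smooth_on ?T (\<lambda>x. k ((\<psi> \<circ> inv_into U \<phi>) x))"
        using smooth_on_compose[OF oT W(1) _ k] by blast
      then have "smooth_on ?T (chart_extend V \<psi> W k \<circ> inv_into U \<phi>)"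
        by (rule smooth_on_cong[OF oT, rotated])
          (use is_chartD(5)[OF cU] in \<open>auto simp: chart_extend_def\<close>)
      then show ?thesis using oT True p by blast
    next
      case False
      let ?T = "\<phi> ` (U \<inter> - ?L)"
      have oT: "open ?T" using chart_image_open[OF cU L] .
      have "smooth_on ?T (chart_extend V \<psi> W k \<circ> inv_into U \<phi>)"
        by (rule smooth_on_cong[OF oT _ smooth_on_const[OF oT, of 0]])
          (use is_chartD(5)[OF cU] zero in auto)
      moreover have "x \<in> ?T" using False p L_sub by blast
      ultimately show ?thesis using oT by blast
    qed
  qed
qed

text \<open>Directional derivative along \<open>w\<close> in the chart, set to 0 on non-smooth
  functions to follow the convention of \<open>tangent_space\<close>.\<close>

definition chart_vector ::
  "('a::topological_space, 'e::euclidean_space) chart set \<Rightarrow> 'a set \<Rightarrow> ('a \<Rightarrow> 'e) \<Rightarrow> 'a \<Rightarrow> 'e \<Rightarrow> 'a tvec"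
  where
  "chart_vector A V \<psi> p w = (\<lambda>f. if f \<in> smooth_functions A
     then frechet_derivative (f \<circ> inv_into V \<psi>) (at (\<psi> p)) w else 0)"

lemma chart_vector_tangent:
  assumes A: "smooth_manifold A" and V: "(V, \<psi>) \<in> A" "p \<in> V"
  shows "chart_vector A V \<psi> p w \<in> tangent_space A p"
proof -
  note D = smooth_functions_chart_has_derivative[OF _ V]
  note inv = is_chartD(5)[OF smooth_manifold_chart[OF A V(1)] V(2)]
  have lin: "frechet_derivative ((\<lambda>x. a * f x + b * h x) \<circ> inv_into V \<psi>) (at (\<psi> p)) w =
      a * frechet_derivative (f \<circ> inv_into V \<psi>) (at (\<psi> p)) w +
      b * frechet_derivative (h \<circ> inv_into V \<psi>) (at (\<psi> p)) w"
    if "f \<in> smooth_functions A" "h \<in> smooth_functions A" for f h a b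
  proof -
    have "((\<lambda>y. a * (f \<circ> inv_into V \<psi>) y + b * (h \<circ> inv_into V \<psi>) y) has_derivative
      (\<lambda>w. a * frechet_derivative (f \<circ> inv_into V \<psi>) (at (\<psi> p)) w +
      b * frechet_derivative (h \<circ> inv_into V \<psi>) (at (\<psi> p)) w)) (at (\<psi> p))"
      by (intro has_derivative_add has_derivative_mult_right D that)
    from fun_cong[OF frechet_derivative_at[OF this], of w] show ?thesis by (simp add: o_def)
  qed
  have leibniz: "frechet_derivative ((\<lambda>x. f x * h x) \<circ> inv_into V \<psi>) (at (\<psi> p)) w =
      frechet_derivative (f \<circ> inv_into V \<psi>) (at (\<psi> p)) w * h p +
      f p * frechet_derivative (h \<circ> inv_into V \<psi>) (at (\<psi> p)) w"
    if "f \<in> smooth_functions A" "h \<in> smooth_functions A" for f h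
  proof -
    from fun_cong[OF frechet_derivative_at[OF has_derivative_mult[OF D[OF that(1)] D[OF that(2)]]], of w]
    show ?thesis by (simp add: o_def inv)
  qed
  have "(\<lambda>x. a * f x + b * h x) \<in> smooth_functions A"
    if "f \<in> smooth_functions A" "h \<in> smooth_functions A" for f h and a b :: real
    by (intro smooth_functions_add smooth_functions_mult smooth_functions_const A that)
  then show ?thesis
    using lin leibniz smooth_functions_mult[OF A]
    unfolding chart_vector_def tangent_space_def by simp
qed

lemma chart_vector_lincomb:
  assumes "(V, \<psi>) \<in> A" "p \<in> V"
  shows "chart_vector A V \<psi> p (a *\<^sub>R w + b *\<^sub>R w') =
    lincomb a (chart_vector A V \<psi> p w) b (chart_vector A V \<psi> p w')"
proof (rule ext)
  fix f
  show "chart_vector A V \<psi> p (a *\<^sub>R w + b *\<^sub>R w') f =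
    lincomb a (chart_vector A V \<psi> p w) b (chart_vector A V \<psi> p w') f"
  proof (cases "f \<in> smooth_functions A")
    case True
    interpret bounded_linear "frechet_derivative (f \<circ> inv_into V \<psi>) (at (\<psi> p))"
      using smooth_functions_chart_has_derivative[OF True assms] has_derivative_bounded_linear by blast
    show ?thesis using True by (simp add: chart_vector_def lincomb_def add scale)
  qed (simp add: chart_vector_def lincomb_def)
qed

text \<open>The functions \<open>\<xi> b\<close> are the coordinates centred at \<open>p\<close>, cut off away from \<open>p\<close>. To evaluate a
  derivation at \<open>f\<close>, apply it to \<open>\<chi>\<^sup>2 (f - f p) = \<Sum>b. \<xi> b * \<eta> b\<close>, where \<open>\<chi>\<close> is the cutoff and
  \<open>\<eta> b\<close> the cut-off coefficients in Hadamard's lemma; only \<open>\<chi> p = 1\<close> is needed.\<close>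

lemma chart_coordinates:
  fixes A :: "('a::{t2_space,second_countable_topology}, 'e::euclidean_space) chart set"
  assumes A: "smooth_manifold A" and V: "(V, \<psi>) \<in> A" "p \<in> V"
  obtains \<xi> where "\<And>b. \<xi> b \<in> smooth_functions A"
    "\<And>v. v \<in> tangent_space A p \<Longrightarrow> v = chart_vector A V \<psi> p (\<Sum>b\<in>Basis. v (\<xi> b) *\<^sub>R b)"
    "\<And>w b. chart_vector A V \<psi> p w (\<xi> b) = w \<bullet> b"
proof -
  note cV = smooth_manifold_chart[OF A V(1)]
  let ?x0 = "\<psi> p"
  obtain R where R: "R > 0" "ball ?x0 R \<subseteq> \<psi> ` V"
    using is_chartD(2)[OF cV] V(2) open_contains_ball by blast
  obtain \<beta> :: "'e \<Rightarrow> real" where \<beta>: "smooth_on UNIV \<beta>" "\<beta> ?x0 = 1"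
      "\<And>x. x \<notin> cball ?x0 (R / 2) \<Longrightarrow> \<beta> x = 0"
    using smooth_bump[of "R / 2" ?x0] R(1) by auto
  let ?W = "ball ?x0 R"
  let ?E = "\<lambda>k. chart_extend V \<psi> ?W (\<lambda>y. \<beta> y * k y)"
  have E: "?E k \<in> smooth_functions A" if "smooth_on ?W k" for k
    by (rule chart_extend_smooth[OF A V(1) _ open_ball R(2), where K = "cball ?x0 (R / 2)"])
      (use R(1) \<beta>(3) smooth_on_mult[OF open_ball smooth_on_subset[OF \<beta>(1)] that] in auto)
  have E_p: "?E k p = k ?x0" for k
    using V(2) R(1) \<beta>(2) by (simp add: chart_extend_def)
  let ?coord = "\<lambda>b y. (y + - ?x0) \<bullet> b"
  have coord: "smooth_on ?W (?coord b)" for b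
    by (intro smooth_on_inner smooth_on_add smooth_on_const smooth_on_bounded_linear
        bounded_linear_ident open_ball)
  let ?\<xi> = "\<lambda>b. ?E (?coord b)"
  have \<xi>: "?\<xi> b \<in> smooth_functions A" for b using E[OF coord] .
  have "v = chart_vector A V \<psi> p (\<Sum>b\<in>Basis. v (?\<xi> b) *\<^sub>R b)" if v: "v \<in> tangent_space A p" for v
  proof (rule ext)
    fix f
    show "v f = chart_vector A V \<psi> p (\<Sum>b\<in>Basis. v (?\<xi> b) *\<^sub>R b) f"
    proof (cases "f \<in> smooth_functions A")
      case True
      let ?F = "f \<circ> inv_into V \<psi>"
      have "smooth_on ?W ?F"
        using True V(1) R(2) smooth_on_subset unfolding smooth_functions_def by blast
      from smooth_on_first_order_remainder[OF this R(1)] obtain q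
        where q: "\<And>b. smooth_on ?W (q b)" "\<And>b. q b ?x0 = frechet_derivative ?F (at ?x0) b"
          "\<And>y. y \<in> ?W \<Longrightarrow> ?F y = ?F ?x0 + (\<Sum>b\<in>Basis. ((y - ?x0) \<bullet> b) * q b y)"
        by blast
      let ?\<eta> = "\<lambda>b. ?E (q b)" and ?\<chi> = "?E (\<lambda>y. 1)"
      have \<chi>: "?\<chi> \<in> smooth_functions A" by (intro E smooth_on_const open_ball)
      \<comment> \<open>The difference f - f p is written as a linear combination of f and 1, the
        shape to which the linearity clause of \<open>tangent_space\<close> applies.\<close>
      have d: "(\<lambda>x. 1 * f x + (- f p) * 1) \<in> smooth_functions A"
        by (intro smooth_functions_add smooth_functions_mult smooth_functions_const A True)
      have "(\<lambda>x. (?\<chi> x * ?\<chi> x) * (1 * f x + (- f p) * 1)) = (\<lambda>x. \<Sum>b\<in>Basis. ?\<xi> b x * ?\<eta> b x)"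
      proof (rule ext)
        fix x
        show "(?\<chi> x * ?\<chi> x) * (1 * f x + (- f p) * 1) = (\<Sum>b\<in>Basis. ?\<xi> b x * ?\<eta> b x)"
        proof (cases "x \<in> V \<and> \<psi> x \<in> ?W")
          case True
          then have "f x - f p = (\<Sum>b\<in>Basis. ((\<psi> x - ?x0) \<bullet> b) * q b (\<psi> x))"
            using q(3)[of "\<psi> x"] is_chartD(5)[OF cV] V(2) by simp
          then show ?thesis using True
            by (simp add: chart_extend_def sum_distrib_left mult_ac)
        next
          case False
          then show ?thesis by (auto simp: chart_extend_def)
        qed
      qed
      then have "v (\<lambda>x. (?\<chi> x * ?\<chi> x) * (1 * f x + (- f p) * 1)) = v (\<lambda>x. \<Sum>b\<in>Basis. ?\<xi> b x * ?\<eta> b x)"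
        by (rule arg_cong)
      \<comment> \<open>In the Leibniz rule the term with the derivative of the squared cutoff drops
        out, because f - f p vanishes at \<open>p\<close>; the constant f p is killed by
        \<open>v\<close>.\<close>
      moreover have "v (\<lambda>x. (?\<chi> x * ?\<chi> x) * (1 * f x + (- f p) * 1)) = v f"
        unfolding tangent_spaceD(3)[OF v smooth_functions_mult[OF A \<chi> \<chi>] d]
          tangent_spaceD(2)[OF v True smooth_functions_const[OF A]] tangent_space_const[OF A v] E_p
        by simp
      moreover have "v (\<lambda>x. \<Sum>b\<in>Basis. ?\<xi> b x * ?\<eta> b x) = (\<Sum>b\<in>Basis. v (\<lambda>x. ?\<xi> b x * ?\<eta> b x))"
        by (rule tangent_space_sum[OF A v smooth_functions_mult[OF A \<xi> E[OF q(1)]]])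
      \<comment> \<open>The centred coordinate vanishes at \<open>p\<close>, so only the term with
        the value of the Hadamard coefficient at \<open>p\<close> survives.\<close>
      moreover have "v (\<lambda>x. ?\<xi> b x * ?\<eta> b x) = v (?\<xi> b) * frechet_derivative ?F (at ?x0) b" for b
        unfolding tangent_spaceD(3)[OF v \<xi> E[OF q(1)]] E_p q(2) by simp
      ultimately have "v f = (\<Sum>b\<in>Basis. v (?\<xi> b) * frechet_derivative ?F (at ?x0) b)" by simp
      also have "\<dots> = frechet_derivative ?F (at ?x0) (\<Sum>b\<in>Basis. v (?\<xi> b) *\<^sub>R b)"
      proof -
        interpret bounded_linear "frechet_derivative ?F (at ?x0)"
          using smooth_functions_chart_has_derivative[OF True V] has_derivative_bounded_linear by blast
        show ?thesis by (simp only: sum scale real_scaleR_def)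
      qed
      finally show ?thesis using True by (simp add: chart_vector_def)
    qed (simp add: chart_vector_def tangent_spaceD(1)[OF v])
  qed
  moreover have "chart_vector A V \<psi> p w (?\<xi> b) = w \<bullet> b" for w b
  proof -
    \<comment> \<open>The derivative of the bump function is multiplied by the coordinate at the
      centre, which is 0, and the bump function itself is 1 there.\<close>
    have "((\<lambda>y. \<beta> y * ?coord b y) has_derivative
        (\<lambda>w. \<beta> ?x0 * (w \<bullet> b) + frechet_derivative \<beta> (at ?x0) w * ?coord b ?x0)) (at ?x0)"
      by (intro has_derivative_mult smooth_on_frechet(1)[OF \<beta>(1)] UNIV_I)
        (auto intro!: derivative_eq_intros)
    then have "((\<lambda>y. \<beta> y * ?coord b y) has_derivative (\<lambda>w. w \<bullet> b)) (at ?x0)"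
      using \<beta>(2) by simp
    then have "(?\<xi> b \<circ> inv_into V \<psi> has_derivative (\<lambda>w. w \<bullet> b)) (at ?x0)"
    proof (rule has_derivative_transform_within_open[OF _ open_ball])
      show "?x0 \<in> ?W" using R(1) by simp
      fix y assume y: "y \<in> ?W"
      then obtain x where "x \<in> V" "y = \<psi> x" using R(2) by blast
      then show "\<beta> y * ?coord b y = (?\<xi> b \<circ> inv_into V \<psi>) y"
        using y is_chartD(5)[OF cV] by (simp add: chart_extend_def)
    qed
    note frechet_derivative_at[OF this, symmetric]
    then show ?thesis
      unfolding chart_vector_def if_P[OF \<xi>] by (rule fun_cong)
  qed
  ultimately show thesis by (rule that[OF \<xi>])
qed

section \<open>Left invariant vector fields\<close>

lemma smooth_on_Pair_const:
  fixes S :: "'e::euclidean_space set" and c :: "'f::euclidean_space"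
  assumes "open S"
  shows "smooth_on S (\<lambda>y. (c, y))" "smooth_on S (\<lambda>y. (y, c))"
proof -
  have "smooth_on S (\<lambda>y. (c, 0) + (0, y))" "smooth_on S (\<lambda>y. (y, 0) + (0, c))"
    by (intro smooth_on_add smooth_on_const smooth_on_bounded_linear assms bounded_linear_Pair
        bounded_linear_zero bounded_linear_ident)+
  then show "smooth_on S (\<lambda>y. (c, y))" "smooth_on S (\<lambda>y. (y, c))" by simp_all
qed

section \<open>Multiplication and left translations in charts\<close>

locale lie_group_atlas =
  fixes G :: "('a::{t2_space,second_countable_topology}) monoid" (structure)
    and A :: "('a, 'e::euclidean_space) chart set"
  assumes lie_group: "lie_group G A"
begin

lemma carrier [simp]: "carrier G = UNIV"
  using lie_group unfolding lie_group_def by blast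

sublocale group G
  using lie_group unfolding lie_group_def by blast

lemma manifold: "smooth_manifold A"
  using lie_group unfolding lie_group_def by blast

lemma chart: "(U, \<phi>) \<in> A \<Longrightarrow> is_chart (U, \<phi>)"
  using smooth_manifold_chart[OF manifold] .

text \<open>The products of elements of \<open>U\<close> and \<open>V\<close> need not lie in a
  single chart. Near each point a chart \<open>W\<close> around the product is chosen, and the
  function factors there through the coordinate expression of the multiplication.\<close>

lemma smooth_on_mult_charts:
  assumes f: "f \<in> smooth_functions A" and U: "(U, \<phi>) \<in> A" and V: "(V, \<psi>) \<in> A"
  shows "smooth_on (\<phi> ` U \<times> \<psi> ` V) (\<lambda>(x, y). f (inv_into U \<phi> x \<otimes> inv_into V \<psi> y))"
proof (rule smooth_on_local)
  fix z assume z: "z \<in> \<phi> ` U \<times> \<psi> ` V"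
  let ?m = "\<lambda>(a, b). a \<otimes> b"
  let ?i = "\<lambda>z. (inv_into U \<phi> (fst z), inv_into V \<psi> (snd z))"
  obtain W \<theta> where W: "(W, \<theta>) \<in> A" "?m (?i z) \<in> W"
    using smooth_manifold_covers[OF manifold] .
  let ?S = "map_prod \<phi> \<psi> ` (U \<times> V \<inter> ?m -` W)"
  have smooth_m: "continuous_on UNIV ?m"
    "smooth_on ?S (\<theta> \<circ> ?m \<circ> inv_into (U \<times> V) (map_prod \<phi> \<psi>))"
    using lie_group U V W(1) unfolding lie_group_def smooth_map_def prod_atlas_def by blast+
  have inv: "inv_into (U \<times> V) (map_prod \<phi> \<psi>) (map_prod \<phi> \<psi> q) = q" if "q \<in> U \<times> V" for q
    using is_chartD(5)[OF chart[OF U]] is_chartD(5)[OF chart[OF V]] that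
    by (intro inv_into_f_f) (auto simp: inj_on_def, metis+)
  have i: "?i (map_prod \<phi> \<psi> q) = q" if "q \<in> U \<times> V" for q
    using is_chartD(5)[OF chart[OF U]] is_chartD(5)[OF chart[OF V]] that by auto
  \<comment> \<open>As a preimage under a continuous map on an open set, \<open>?S\<close> is seen
    to be open.\<close>
  have S: "?S = (\<phi> ` U \<times> \<psi> ` V) \<inter> (\<lambda>z. ?m (?i z)) -` W"
  proof
    show "?S \<subseteq> (\<phi> ` U \<times> \<psi> ` V) \<inter> (\<lambda>z. ?m (?i z)) -` W"
      using i by fastforce
    show "(\<phi> ` U \<times> \<psi> ` V) \<inter> (\<lambda>z. ?m (?i z)) -` W \<subseteq> ?S"
    proof
      fix y assume y: "y \<in> (\<phi> ` U \<times> \<psi> ` V) \<inter> (\<lambda>z. ?m (?i z)) -` W"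
      then obtain q where q: "q \<in> U \<times> V" "y = map_prod \<phi> \<psi> q" by auto
      have "?m (?i y) \<in> W" using y by blast
      then have "?m q \<in> W" unfolding q(2) i[OF q(1)] .
      then show "y \<in> ?S" using q by blast
    qed
  qed
  have "continuous_on (\<phi> ` U \<times> \<psi> ` V) ?i"
    by (intro continuous_on_Pair continuous_on_compose2[OF is_chartD(4)[OF chart[OF U]] continuous_on_fst]
        continuous_on_compose2[OF is_chartD(4)[OF chart[OF V]] continuous_on_snd] continuous_on_id) auto
  then have "continuous_on (\<phi> ` U \<times> \<psi> ` V) (\<lambda>z. ?m (?i z))"
    by (rule continuous_on_compose2[OF smooth_m(1)]) simp
  then have oS: "open ?S" unfolding S
    by (rule continuous_open_preimage)
      (intro open_Times is_chartD(2) chart U V is_chartD(1)[OF chart[OF W(1)]])+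
  have "smooth_on (\<theta> ` W) (f \<circ> inv_into W \<theta>)"
    using f W(1) unfolding smooth_functions_def by blast
  moreover have "(\<theta> \<circ> ?m \<circ> inv_into (U \<times> V) (map_prod \<phi> \<psi>)) ` ?S \<subseteq> \<theta> ` W"
    using inv by fastforce
  ultimately have "smooth_on ?S
      (\<lambda>z. (f \<circ> inv_into W \<theta>) ((\<theta> \<circ> ?m \<circ> inv_into (U \<times> V) (map_prod \<phi> \<psi>)) z))"
    using smooth_on_compose[OF oS is_chartD(2)[OF chart[OF W(1)]]] smooth_m(2) by blast
  then have "smooth_on ?S (\<lambda>(x, y). f (inv_into U \<phi> x \<otimes> inv_into V \<psi> y))"
  proof (rule smooth_on_cong[OF oS, rotated])
    fix z assume "z \<in> ?S"
    then obtain q where q: "q \<in> U \<times> V" "?m q \<in> W" "z = map_prod \<phi> \<psi> q"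
      by (elim imageE IntE vimageE) simp
    have "(f \<circ> inv_into W \<theta>) ((\<theta> \<circ> ?m \<circ> inv_into (U \<times> V) (map_prod \<phi> \<psi>)) z) = f (?m q)"
      using inv[OF q(1)] is_chartD(5)[OF chart[OF W(1)] q(2)] q(3) by simp
    also have "\<dots> = f (?m (?i z))" using i[OF q(1)] q(3) by simp
    finally show "(f \<circ> inv_into W \<theta>) ((\<theta> \<circ> ?m \<circ> inv_into (U \<times> V) (map_prod \<phi> \<psi>)) z)
        = (case z of (x, y) \<Rightarrow> f (inv_into U \<phi> x \<otimes> inv_into V \<psi> y))"
      by (simp add: case_prod_unfold)
  qed
  moreover have "z \<in> ?S" unfolding S using z W(2) by (intro IntI vimageI2)
  ultimately show "\<exists>T. open T \<and> z \<in> T \<and> smooth_on T (\<lambda>(x, y). f (inv_into U \<phi> x \<otimes> inv_into V \<psi> y))"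
    using oS by blast
qed

text \<open>Restrict the two-variable function of \<open>smooth_on_mult_charts\<close> to the slice
  whose first coordinate represents \<open>a\<close>.\<close>

lemma smooth_functions_left_translate:
  assumes f: "f \<in> smooth_functions A"
  shows "f \<circ> (\<lambda>b. a \<otimes> b) \<in> smooth_functions A"
  unfolding smooth_functions_def
proof clarify
  fix V \<psi> assume V: "(V, \<psi>) \<in> A"
  obtain U \<phi> where U: "(U, \<phi>) \<in> A" "a \<in> U" using smooth_manifold_covers[OF manifold] .
  have "smooth_on (\<psi> ` V)
      (\<lambda>y. case (\<phi> a, y) of (x, y) \<Rightarrow> f (inv_into U \<phi> x \<otimes> inv_into V \<psi> y))"
    by (rule smooth_on_compose[OF _ _ _ smooth_on_mult_charts[OF f U(1) V] smooth_on_Pair_const(1)])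
      (use U(2) in \<open>auto intro!: open_Times is_chartD(2) chart U V\<close>)
  then show "smooth_on (\<psi> ` V) (f \<circ> (\<lambda>b. a \<otimes> b) \<circ> inv_into V \<psi>)"
    using is_chartD(5)[OF chart[OF U(1)] U(2)] by (simp add: o_def)
qed

lemma d_left_apply:
  "f \<in> smooth_functions A \<Longrightarrow> d_left G A a v f = v (f \<circ> (\<lambda>b. a \<otimes> b))"
  "f \<notin> smooth_functions A \<Longrightarrow> d_left G A a v f = 0"
  by (simp_all add: d_left_def push_forward_def)

lemma d_left_tangent:
  assumes v: "v \<in> tangent_space A b"
  shows "d_left G A a v \<in> tangent_space A (a \<otimes> b)"
proof -
  have "(\<lambda>x. c * f x + d * h x) \<in> smooth_functions A" "(\<lambda>x. f x * h x) \<in> smooth_functions A"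
    if "f \<in> smooth_functions A" "h \<in> smooth_functions A" for f h and c d :: real
    by (intro smooth_functions_add smooth_functions_mult smooth_functions_const manifold that)+
  moreover note tangent_spaceD(2,3)[OF v smooth_functions_left_translate smooth_functions_left_translate]
  ultimately show ?thesis
    unfolding tangent_space_def by (simp add: d_left_apply o_def)
qed

lemma d_left_mult:
  "d_left G A a (d_left G A b v) = d_left G A (a \<otimes> b) v"
proof (rule ext)
  fix f
  show "d_left G A a (d_left G A b v) f = d_left G A (a \<otimes> b) v f"
  proof (cases "f \<in> smooth_functions A")
    case True
    then show ?thesis
      unfolding d_left_apply(1)[OF True] d_left_apply(1)[OF smooth_functions_left_translate[OF True]]
      by (simp add: o_def m_assoc)
  qed (simp add: d_left_apply)
qed

text \<open>Since \<open>d_left\<close> returns 0 on non-smooth functions, \<open>v\<close> must be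
  a tangent vector: it then vanishes there as well.\<close>

lemma d_left_one:
  assumes "v \<in> tangent_space A b"
  shows "d_left G A \<one> v = v"
proof (rule ext)
  fix f
  show "d_left G A \<one> v f = v f"
    using tangent_spaceD(1)[OF assms]
    by (cases "f \<in> smooth_functions A") (simp_all add: d_left_apply o_def)
qed

text \<open>By \<open>chart_coordinates\<close>, \<open>v\<close> is a directional derivative
  \<open>w\<close> at the identity. Applying the translated vector to f is then a partial
  derivative, in direction (0, w), of the smooth coordinate expression of f(ab), hence smooth in
  a.\<close>

lemma d_left_in_lie_algebra:
  assumes v: "v \<in> tangent_space A \<one>"
  shows "(\<lambda>a. d_left G A a v) \<in> lie_algebra G A"
proof -
  obtain V \<psi> where V: "(V, \<psi>) \<in> A" "\<one> \<in> V" using smooth_manifold_covers[OF manifold] .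
  obtain w where w: "v = chart_vector A V \<psi> \<one> w"
    using chart_coordinates[OF manifold V] v by metis
  have "(\<lambda>a. d_left G A a v f) \<in> smooth_functions A" if f: "f \<in> smooth_functions A" for f
    unfolding smooth_functions_def
  proof clarify
    fix U \<phi> assume U: "(U, \<phi>) \<in> A"
    let ?F = "\<lambda>(x, y). f (inv_into U \<phi> x \<otimes> inv_into V \<psi> y)"
    note F = smooth_on_mult_charts[OF f U V(1)]
    have oU: "open (\<phi> ` U)" and oUV: "open (\<phi> ` U \<times> \<psi> ` V)"
      by (intro open_Times is_chartD(2) chart U V)+
    have "smooth_on (\<phi> ` U) (\<lambda>x. frechet_derivative ?F (at (x, \<psi> \<one>)) (0, w))"
      by (rule smooth_on_compose[OF oU oUV _ smooth_on_frechet(2)[OF F] smooth_on_Pair_const(2)[OF oU]])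
        (use V(2) in auto)
    then show "smooth_on (\<phi> ` U) ((\<lambda>a. d_left G A a v f) \<circ> inv_into U \<phi>)"
    proof (rule smooth_on_cong[OF oU, rotated])
      fix x assume x: "x \<in> \<phi> ` U"
      have "(?F has_derivative frechet_derivative ?F (at (x, \<psi> \<one>))) (at (x, \<psi> \<one>))"
        using smooth_on_frechet(1)[OF F] x V(2) by blast
      moreover have "((\<lambda>y. (x, y)) has_derivative (\<lambda>w. (0, w))) (at (\<psi> \<one>))"
        by (auto intro!: derivative_eq_intros)
      ultimately have der: "((\<lambda>y. ?F (x, y)) has_derivative
          (\<lambda>w. frechet_derivative ?F (at (x, \<psi> \<one>)) (0, w))) (at (\<psi> \<one>))"
        using has_derivative_compose by blast
      have eq: "(\<lambda>y. ?F (x, y)) = f \<circ> (\<lambda>b. inv_into U \<phi> x \<otimes> b) \<circ> inv_into V \<psi>"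
        by (simp add: o_def)
      have "(f \<circ> (\<lambda>b. inv_into U \<phi> x \<otimes> b) \<circ> inv_into V \<psi> has_derivative
          (\<lambda>w. frechet_derivative ?F (at (x, \<psi> \<one>)) (0, w))) (at (\<psi> \<one>))"
        using der unfolding eq .
      from fun_cong[OF frechet_derivative_at[OF this], of w]
      show "frechet_derivative ?F (at (x, \<psi> \<one>)) (0, w) = ((\<lambda>a. d_left G A a v f) \<circ> inv_into U \<phi>) x"
        using smooth_functions_left_translate[OF f]
        unfolding comp_apply d_left_apply(1)[OF f] w chart_vector_def by simp
    qed
  qed
  moreover have "d_left G A a v \<in> tangent_space A a" for a
    using d_left_tangent[OF v, of a] by simp
  ultimately show ?thesis
    by (simp add: lie_algebra_def vfields_def d_left_mult)
qed

lemma lie_algebra_vfield: "X \<in> lie_algebra G A \<Longrightarrow> X \<in> vfields A"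
  by (simp add: lie_algebra_def)

text \<open>Carry \<open>u\<close> back to the identity by the inverse of \<open>p\<close>, then
  translate the result over the whole group. Identities at a point can thus be tested on left
  invariant fields.\<close>

lemma lie_algebra_through:
  assumes u: "u \<in> tangent_space A p"
  obtains X where "X \<in> lie_algebra G A" "X p = u"
proof
  have "d_left G A (inv p) u \<in> tangent_space A \<one>"
    using d_left_tangent[OF u, of "inv p"] by simp
  then show "(\<lambda>a. d_left G A a (d_left G A (inv p) u)) \<in> lie_algebra G A"
    by (rule d_left_in_lie_algebra)
  show "d_left G A p (d_left G A (inv p) u) = u"
    using d_left_one[OF u] by (simp add: d_left_mult)
qed

text \<open>The Gram matrix of a left invariant frame is constant, so the coefficients of a vector
  field with respect to the frame are its products with the dual frame.\<close>

lemma left_invariant_dual_frames: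
  assumes g: "pseudo_riemannian A g" and left: "left_inv_metric G A g"
  obtains E D :: "'e \<Rightarrow> 'a vfield"
  where "\<And>b. E b \<in> lie_algebra G A" "\<And>b. D b \<in> lie_algebra G A"
    "\<And>p u. u \<in> tangent_space A p \<Longrightarrow> u = (\<lambda>f. \<Sum>b\<in>Basis. g p (D b p) u * E b p f)"
proof -
  obtain V \<psi> where V: "(V, \<psi>) \<in> A" "\<one> \<in> V" using smooth_manifold_covers[OF manifold] .
  let ?c = "chart_vector A V \<psi> \<one>"
  obtain \<xi> where \<xi>:
      "\<And>v. v \<in> tangent_space A \<one> \<Longrightarrow> v = ?c (\<Sum>b\<in>Basis. v (\<xi> b) *\<^sub>R b)"
      "\<And>w b. ?c w (\<xi> b) = w \<bullet> b"
    using chart_coordinates[OF manifold V] by metis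
  have c: "?c w \<in> tangent_space A \<one>" for w using chart_vector_tangent[OF manifold V] .
  have c_lin: "?c (a *\<^sub>R w + b *\<^sub>R w') = lincomb a (?c w) b (?c w')" for a w b w'
    using chart_vector_lincomb[OF V] .
  let ?B = "\<lambda>w w'. g \<one> (?c w) (?c w')"
  have sym: "?B w w' = ?B w' w" for w w'
    using g c unfolding pseudo_riemannian_def by blast
  have "?B (a *\<^sub>R w + b *\<^sub>R w') u = a * ?B w u + b * ?B w' u" for a w b w' u
    unfolding c_lin using g c unfolding pseudo_riemannian_def by blast
  \<comment> \<open>Both coefficients equal to 1 give additivity; second coefficient 0 gives
    homogeneity.\<close>
  from this[of 1 _ 1] this[of _ _ 0] have lin1: "linear (\<lambda>w. ?B w u)" for u
    by (intro linearI) simp_all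
  then have lin2: "linear (?B w)" for w by (simp add: sym[of w])
  have expand: "\<phi> w = (\<Sum>b\<in>Basis. (w \<bullet> b) * \<phi> b)" if "linear \<phi>" for \<phi> :: "'e \<Rightarrow> real" and w
  proof -
    have "\<phi> (\<Sum>b\<in>Basis. (w \<bullet> b) *\<^sub>R b) = (\<Sum>b\<in>Basis. (w \<bullet> b) * \<phi> b)"
      using that by (simp add: linear_sum linear_scale)
    then show ?thesis by (simp add: euclidean_representation)
  qed
  \<comment> \<open>The Gram form at the identity as an endomorphism of the coordinate space. Its
    kernel is trivial: a vector in it is orthogonal to every tangent vector, so nondegeneracy makes
    it zero, and the coordinates \<open>\<xi>\<close> then give w = 0.\<close>
  let ?L = "\<lambda>w. \<Sum>b\<in>Basis. ?B w b *\<^sub>R b"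
  have L: "linear ?L"
    using linear_add[OF lin1] linear_scale[OF lin1]
    by (intro linearI) (simp_all add: scaleR_add_left sum.distrib scaleR_sum_right)
  have "w = 0" if "?L w = 0" for w
  proof -
    have "?B w b = 0" if "b \<in> Basis" for b
      using \<open>?L w = 0\<close> inner_sum_left_Basis[OF that, of "?B w"] by simp
    then have "?B w w' = 0" for w' using expand[OF lin2, of w w'] by simp
    then have "g \<one> (?c w) v = 0" if "v \<in> tangent_space A \<one>" for v
      using \<xi>(1)[OF that] by metis
    then have "?c w = (\<lambda>f. 0)" using g c unfolding pseudo_riemannian_def by blast
    then have "w \<bullet> b = 0" for b using \<xi>(2)[of w b] by simp
    from this[of w] show "w = 0" by simp
  qed
  then have surj: "surj ?L"
    using linear_injective_imp_surjective[OF L] linear_injective_0[OF L] by blast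
  \<comment> \<open>Injectivity in finite dimension gives surjectivity; the preimages
    \<open>s b\<close> of the basis vectors form the dual basis for the Gram form.\<close>
  obtain s where s: "\<And>b. ?L (s b) = b" by (rule that[OF surj_f_inv_f[OF surj]])
  have dual: "?B (s b) w = w \<bullet> b" for b w
  proof -
    have "?B (s b) d = d \<bullet> b" if "d \<in> Basis" for d
      using inner_sum_left_Basis[OF that, of "?B (s b)"] s[of b] by (simp add: inner_commute)
    then have "?B (s b) w = (\<Sum>d\<in>Basis. (w \<bullet> d) * (d \<bullet> b))" using expand[OF lin2, of "s b" w] by simp
    also have "\<dots> = w \<bullet> b" by (subst (2) euclidean_inner) (simp add: inner_commute)
    finally show ?thesis .
  qed
  show thesis
  proof (rule that)
    show "(\<lambda>a. d_left G A a (?c b)) \<in> lie_algebra G A" "(\<lambda>a. d_left G A a (?c (s b))) \<in> lie_algebra G A"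
      for b using d_left_in_lie_algebra c by blast+
    fix p u assume u: "u \<in> tangent_space A p"
    let ?u = "d_left G A (inv p) u"
    have u1: "?u \<in> tangent_space A \<one>" using d_left_tangent[OF u, of "inv p"] by simp
    then obtain w where w: "?u = ?c w" using \<xi>(1) by blast
    have u2: "d_left G A p ?u = u" using d_left_one[OF u] by (simp add: d_left_mult)
    have coeff: "g p (d_left G A p (?c (s b))) u = w \<bullet> b" for b
    proof -
      have "g (p \<otimes> \<one>) (d_left G A p (?c (s b))) (d_left G A p ?u) = g \<one> (?c (s b)) ?u"
        using left c u1 unfolding left_inv_metric_def by blast
      then show ?thesis unfolding u2 unfolding w dual by simp
    qed
    show "u = (\<lambda>f. \<Sum>b\<in>Basis. g p (d_left G A p (?c (s b))) u * d_left G A p (?c b) f)"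
    proof (rule ext)
      fix f
      have lin_f: "linear (\<lambda>w. ?c w h)" for h
        using fun_cong[OF c_lin[of 1 _ 1]] fun_cong[OF c_lin[of _ _ 0]]
        by (intro linearI) (simp_all add: lincomb_def)
      show "u f = (\<Sum>b\<in>Basis. g p (d_left G A p (?c (s b))) u * d_left G A p (?c b) f)"
      proof (cases "f \<in> smooth_functions A")
        case True
        have "u f = ?c w (f \<circ> (\<lambda>b. p \<otimes> b))"
          using fun_cong[OF u2, of f] unfolding d_left_apply(1)[OF True] w by simp
        then show ?thesis
          unfolding coeff d_left_apply(1)[OF True] using expand[OF lin_f] by metis
      next
        case False
        then show ?thesis using tangent_spaceD(1)[OF u] by (simp add: d_left_apply)
      qed
    qed
  qed
qed

end

section \<open>The covariant derivative of J\<close>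

lemma vfieldsD:
  assumes "X \<in> vfields A"
  shows "X p \<in> tangent_space A p" "f \<in> smooth_functions A \<Longrightarrow> (\<lambda>p. X p f) \<in> smooth_functions A"
  using assms unfolding vfields_def by blast+

text \<open>These conversions bring the operations on fields into the form \<open>lincomb\<close>,
  in which linearity of the metric and of J is stated.\<close>

lemma vf_add_conv_lincomb: "vf_add X Y p = lincomb 1 (X p) 1 (Y p)"
  by (simp add: vf_add_def lincomb_def)

lemma vf_diff_conv_lincomb: "vf_diff X Y p = lincomb 1 (X p) (-1) (Y p)"
  by (simp add: vf_diff_def lincomb_def)

lemma vf_scale_conv_lincomb: "vf_scale h X p = lincomb (h p) (X p) 0 (X p)"
  by (simp add: vf_scale_def lincomb_def)

lemma vf_add_vfields:
  assumes "smooth_manifold A" "X \<in> vfields A" "Y \<in> vfields A"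
  shows "vf_add X Y \<in> vfields A"
proof -
  have "vf_add X Y p \<in> tangent_space A p" for p
    unfolding vf_add_conv_lincomb by (intro lincomb_in_tangent_space vfieldsD(1) assms)
  moreover have "(\<lambda>p. vf_add X Y p f) \<in> smooth_functions A" if "f \<in> smooth_functions A" for f
    unfolding vf_add_def using smooth_functions_add[OF assms(1) vfieldsD(2)[OF assms(2) that]
      vfieldsD(2)[OF assms(3) that]] .
  ultimately show ?thesis unfolding vfields_def by blast
qed

lemma vf_scale_vfields:
  assumes "smooth_manifold A" "h \<in> smooth_functions A" "X \<in> vfields A"
  shows "vf_scale h X \<in> vfields A"
proof -
  have "vf_scale h X p \<in> tangent_space A p" for p
    unfolding vf_scale_conv_lincomb by (intro lincomb_in_tangent_space vfieldsD(1) assms)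
  moreover have "(\<lambda>p. vf_scale h X p f) \<in> smooth_functions A" if "f \<in> smooth_functions A" for f
    unfolding vf_scale_def using smooth_functions_mult[OF assms(1,2) vfieldsD(2)[OF assms(3) that]] .
  ultimately show ?thesis unfolding vfields_def by blast
qed

section \<open>Tensorial properties of the covariant derivative of J\<close>

locale anti_hermitian_connection =
  fixes A :: "('a::{t2_space,second_countable_topology}, 'e::euclidean_space) chart set"
    and g :: "'a bilin_field"
    and J :: "'a endo_field"
    and nab :: "'a vfield \<Rightarrow> 'a vfield \<Rightarrow> 'a vfield"
  assumes manifold: "smooth_manifold A"
    and anti_hermitian: "almost_anti_hermitian A g J"
    and levi_civita: "levi_civita A g nab"
begin

abbreviation "T \<equiv> tangent_space A"

lemma metric: "pseudo_riemannian A g" and complex: "almost_complex A J"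
  using anti_hermitian unfolding almost_anti_hermitian_def by blast+

lemma metric_sym: "u \<in> T p \<Longrightarrow> v \<in> T p \<Longrightarrow> g p u v = g p v u"
  using metric unfolding pseudo_riemannian_def by blast

lemma metric_lincomb: "u \<in> T p \<Longrightarrow> v \<in> T p \<Longrightarrow> w \<in> T p \<Longrightarrow>
    g p (lincomb a u b v) w = a * g p u w + b * g p v w"
  using metric unfolding pseudo_riemannian_def by blast

lemma metric_nondegenerate: "u \<in> T p \<Longrightarrow> (\<And>v. v \<in> T p \<Longrightarrow> g p u v = 0) \<Longrightarrow> u = (\<lambda>f. 0)"
  using metric unfolding pseudo_riemannian_def by blast

lemma J_tangent: "u \<in> T p \<Longrightarrow> J p u \<in> T p"
  using complex unfolding almost_complex_def by blast

lemma J_lincomb: "u \<in> T p \<Longrightarrow> v \<in> T p \<Longrightarrow> J p (lincomb a u b v) = lincomb a (J p u) b (J p v)"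
  using complex unfolding almost_complex_def by blast

lemma J_vfield: "X \<in> vfields A \<Longrightarrow> apply_endo J X \<in> vfields A"
  using complex unfolding almost_complex_def by blast

text \<open>Use the anti-Hermitian identity for u and J v, together with J(J v) = -v.\<close>

lemma J_symmetric:
  assumes u: "u \<in> T p" and v: "v \<in> T p"
  shows "g p (J p u) v = g p u (J p v)"
proof -
  note Ju = J_tangent[OF u] and Jv = J_tangent[OF v]
  have "J p (J p v) = lincomb (-1) v 0 v"
    using complex v unfolding almost_complex_def lincomb_def by simp
  then have "g p (J p u) (J p (J p v)) = - g p (J p u) v"
    using metric_sym[OF Ju] metric_lincomb[OF v v Ju] lincomb_in_tangent_space[OF v v] v by simp
  moreover have "g p (J p u) (J p (J p v)) = - g p u (J p v)"
    using anti_hermitian u Jv unfolding almost_anti_hermitian_def by blast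
  ultimately show ?thesis by simp
qed

lemma nab_vfield: "X \<in> vfields A \<Longrightarrow> Y \<in> vfields A \<Longrightarrow> nab X Y \<in> vfields A"
  using levi_civita unfolding levi_civita_def affine_connection_def by blast

lemma nab_add_left: "X \<in> vfields A \<Longrightarrow> X' \<in> vfields A \<Longrightarrow> Y \<in> vfields A \<Longrightarrow>
    nab (vf_add X X') Y = vf_add (nab X Y) (nab X' Y)"
  using levi_civita unfolding levi_civita_def affine_connection_def by blast

lemma nab_scale_left: "X \<in> vfields A \<Longrightarrow> Y \<in> vfields A \<Longrightarrow> h \<in> smooth_functions A \<Longrightarrow>
    nab (vf_scale h X) Y = vf_scale h (nab X Y)"
  using levi_civita unfolding levi_civita_def affine_connection_def by blast

lemma torsion_free: "X \<in> vfields A \<Longrightarrow> Y \<in> vfields A \<Longrightarrow>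
    lie_bracket X Y = vf_diff (nab X Y) (nab Y X)"
  using levi_civita unfolding levi_civita_def by metis

lemma metric_compatible: "X \<in> vfields A \<Longrightarrow> Y \<in> vfields A \<Longrightarrow> Z \<in> vfields A \<Longrightarrow>
    X p (\<lambda>q. g q (Y q) (Z q)) = g p (nab X Y p) (Z p) + g p (Y p) (nab X Z p)"
  using levi_civita unfolding levi_civita_def by blast

lemma cov_deriv_endo_at:
  "cov_deriv_endo nab J X Y p = lincomb 1 (nab X (apply_endo J Y) p) (-1) (J p (nab X Y p))"
  unfolding cov_deriv_endo_def vf_diff_conv_lincomb by (simp add: apply_endo_def)

lemma cov_deriv_endo_tangent:
  assumes "X \<in> vfields A" "Y \<in> vfields A"
  shows "cov_deriv_endo nab J X Y p \<in> T p"
  unfolding cov_deriv_endo_at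
  by (intro lincomb_in_tangent_space J_tangent vfieldsD(1) nab_vfield J_vfield assms)

text \<open>Symmetry of J moves it onto the test vector, so that both terms become products to which
  the Koszul formula applies.\<close>

lemma metric_cov_deriv_endo:
  assumes X: "X \<in> vfields A" and Y: "Y \<in> vfields A" and u: "u \<in> T p"
  shows "g p (cov_deriv_endo nab J X Y p) u =
    g p (nab X (apply_endo J Y) p) u - g p (nab X Y p) (J p u)"
proof -
  have n: "nab X (apply_endo J Y) p \<in> T p" "nab X Y p \<in> T p"
    by (intro vfieldsD(1) nab_vfield J_vfield assms)+
  show ?thesis
    unfolding cov_deriv_endo_at metric_lincomb[OF n(1) J_tangent[OF n(2)] u] J_symmetric[OF n(2) u]
    by simp
qed

text \<open>Differentiate g(JY, Z) = g(Y, JZ) along X by metric compatibility. This allows an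
  arbitrary second field to be exchanged for a left invariant one.\<close>

lemma cov_deriv_endo_symmetric:
  assumes X: "X \<in> vfields A" and Y: "Y \<in> vfields A" and Z: "Z \<in> vfields A"
  shows "g p (cov_deriv_endo nab J X Y p) (Z p) = g p (Y p) (cov_deriv_endo nab J X Z p)"
proof -
  have JZ: "apply_endo J Z p = J p (Z p)" and JY: "apply_endo J Y p = J p (Y p)" for p
    by (simp_all add: apply_endo_def)
  have "g q (apply_endo J Y q) (Z q) = g q (Y q) (apply_endo J Z q)" for q
    unfolding JZ JY by (intro J_symmetric vfieldsD(1) Y Z)
  then have "X p (\<lambda>q. g q (apply_endo J Y q) (Z q)) = X p (\<lambda>q. g q (Y q) (apply_endo J Z q))"
    by simp
  then have "g p (nab X (apply_endo J Y) p) (Z p) + g p (J p (Y p)) (nab X Z p) =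
      g p (nab X Y p) (J p (Z p)) + g p (Y p) (nab X (apply_endo J Z) p)"
    unfolding metric_compatible[OF X J_vfield[OF Y] Z] metric_compatible[OF X Y J_vfield[OF Z]]
      JY[of p] JZ[of p] .
  moreover have "g p (nab X (apply_endo J Z) p) (Y p) = g p (Y p) (nab X (apply_endo J Z) p)"
    "g p (nab X Z p) (J p (Y p)) = g p (J p (Y p)) (nab X Z p)"
    by (intro metric_sym vfieldsD(1) nab_vfield J_tangent J_vfield X Y Z)+
  moreover have "g p (cov_deriv_endo nab J X Z p) (Y p) = g p (Y p) (cov_deriv_endo nab J X Z p)"
    by (intro metric_sym cov_deriv_endo_tangent vfieldsD(1) X Y Z)
  ultimately show ?thesis
    using metric_cov_deriv_endo[OF X Y vfieldsD(1)[OF Z]] metric_cov_deriv_endo[OF X Z vfieldsD(1)[OF Y]]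
    by simp
qed

lemma cov_deriv_endo_add_left:
  assumes X: "X \<in> vfields A" and X': "X' \<in> vfields A" and Y: "Y \<in> vfields A"
  shows "cov_deriv_endo nab J (vf_add X X') Y = vf_add (cov_deriv_endo nab J X Y) (cov_deriv_endo nab J X' Y)"
proof (rule ext)
  fix p
  have n: "nab X Y p \<in> T p" "nab X' Y p \<in> T p"
    by (intro vfieldsD(1) nab_vfield assms)+
  show "cov_deriv_endo nab J (vf_add X X') Y p =
      vf_add (cov_deriv_endo nab J X Y) (cov_deriv_endo nab J X' Y) p"
    unfolding cov_deriv_endo_at vf_add_conv_lincomb nab_add_left[OF X X' Y]
      nab_add_left[OF X X' J_vfield[OF Y]] J_lincomb[OF n]
    by (simp add: lincomb_def algebra_simps)
qed

lemma cov_deriv_endo_scale_left: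
  assumes h: "h \<in> smooth_functions A" and X: "X \<in> vfields A" and Y: "Y \<in> vfields A"
  shows "cov_deriv_endo nab J (vf_scale h X) Y = vf_scale h (cov_deriv_endo nab J X Y)"
proof (rule ext)
  fix p
  have n: "nab X Y p \<in> T p" by (intro vfieldsD(1) nab_vfield assms)
  show "cov_deriv_endo nab J (vf_scale h X) Y p = vf_scale h (cov_deriv_endo nab J X Y) p"
    unfolding cov_deriv_endo_at vf_scale_conv_lincomb nab_scale_left[OF X Y h]
      nab_scale_left[OF X J_vfield[OF Y] h] J_lincomb[OF n n]
    by (simp add: lincomb_def algebra_simps)
qed

text \<open>Linearity over functions in the first field, carried through a finite expansion.
  Starting the induction at a singleton avoids the zero field. Membership in \<open>vfields\<close>
  is proved alongside because additivity requires it of each partial sum.\<close>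

lemma cov_deriv_endo_sum_left:
  assumes "finite I" and Y: "Y \<in> vfields A"
    and h: "\<And>i. i \<in> I \<Longrightarrow> h i \<in> smooth_functions A" and E: "\<And>i. i \<in> I \<Longrightarrow> E i \<in> vfields A"
    and zero: "\<And>i. i \<in> I \<Longrightarrow> cov_deriv_endo nab J (E i) Y = (\<lambda>p f. 0)"
    and nonempty: "I \<noteq> {}"
  shows "(\<lambda>p f. \<Sum>i\<in>I. h i p * E i p f) \<in> vfields A \<and>
    cov_deriv_endo nab J (\<lambda>p f. \<Sum>i\<in>I. h i p * E i p f) Y = (\<lambda>p f. 0)"
  using assms(1) nonempty h E zero
proof (induction I rule: finite_ne_induct)
  case (singleton i)
  have "(\<lambda>p f. \<Sum>i\<in>{i}. h i p * E i p f) = vf_scale (h i) (E i)" by (simp add: vf_scale_def)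
  moreover have "vf_scale (h i) (E i) \<in> vfields A"
    by (intro vf_scale_vfields manifold singleton) auto
  moreover have "cov_deriv_endo nab J (vf_scale (h i) (E i)) Y = (\<lambda>p f. 0)"
    using cov_deriv_endo_scale_left[of "h i" "E i" Y] singleton Y by (simp add: vf_scale_def)
  ultimately show ?case by (simp only:)
next
  case (insert i I)
  let ?S = "\<lambda>p f. \<Sum>i\<in>I. h i p * E i p f"
  have S: "?S \<in> vfields A" "cov_deriv_endo nab J ?S Y = (\<lambda>p f. 0)"
    using insert by auto
  have "(\<lambda>p f. \<Sum>i\<in>insert i I. h i p * E i p f) = vf_add (vf_scale (h i) (E i)) ?S"
    using insert by (simp add: vf_scale_def vf_add_def)
  moreover have sc: "vf_scale (h i) (E i) \<in> vfields A"
    by (intro vf_scale_vfields manifold insert) auto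
  moreover have "vf_add (vf_scale (h i) (E i)) ?S \<in> vfields A"
    using vf_add_vfields[OF manifold sc S(1)] .
  moreover have "cov_deriv_endo nab J (vf_add (vf_scale (h i) (E i)) ?S) Y = (\<lambda>p f. 0)"
    unfolding cov_deriv_endo_add_left[OF sc S(1) Y] S(2)
    using cov_deriv_endo_scale_left[of "h i" "E i" Y] insert Y by (simp add: vf_scale_def vf_add_def)
  ultimately show ?case by (simp only:)
qed

end

section \<open>Left invariant fields, the Koszul formula and parallelism of J\<close>

locale bi_invariant_connection = lie_group_atlas G A + anti_hermitian_connection A g J nab
  for G :: "('a::{t2_space,second_countable_topology}) monoid" (structure)
    and A :: "('a, 'e::euclidean_space) chart set"
    and g :: "'a bilin_field"
    and J :: "'a endo_field"
    and nab :: "'a vfield \<Rightarrow> 'a vfield \<Rightarrow> 'a vfield" +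
  assumes left_metric: "left_inv_metric G A g"
    and left_J: "left_inv_endo G A J"
    and bi_inv: "bi_invariant G A J"
begin

lemma J_lie_algebra:
  assumes "X \<in> lie_algebra G A"
  shows "apply_endo J X \<in> lie_algebra G A"
proof -
  have "d_left G A a (J b (X b)) = J (a \<otimes> b) (X (a \<otimes> b))" for a b
  proof -
    have "J (a \<otimes> b) (d_left G A a (X b)) = d_left G A a (J b (X b))"
      using left_J vfieldsD(1)[OF lie_algebra_vfield[OF assms]] unfolding left_inv_endo_def by blast
    moreover have "d_left G A a (X b) = X (a \<otimes> b)" using assms unfolding lie_algebra_def by blast
    ultimately show ?thesis by (simp only:)
  qed
  then show ?thesis
    using J_vfield[OF lie_algebra_vfield[OF assms]] unfolding lie_algebra_def apply_endo_def by simp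
qed

lemma metric_lie_algebra_const:
  assumes X: "X \<in> lie_algebra G A" and Y: "Y \<in> lie_algebra G A"
  shows "g p (X p) (Y p) = g \<one> (X \<one>) (Y \<one>)"
proof -
  have t: "X \<one> \<in> T \<one>" "Y \<one> \<in> T \<one>" using vfieldsD(1) lie_algebra_vfield X Y by blast+
  have "g (p \<otimes> \<one>) (d_left G A p (X \<one>)) (d_left G A p (Y \<one>)) = g \<one> (X \<one>) (Y \<one>)"
    using left_metric t unfolding left_inv_metric_def by blast
  moreover have "d_left G A p (X \<one>) = X (p \<otimes> \<one>)" "d_left G A p (Y \<one>) = Y (p \<otimes> \<one>)"
    using X Y unfolding lie_algebra_def by blast+
  ultimately show ?thesis by simp
qed

text \<open>The function g(Y, Z) is constant for left invariant fields, so its derivative in metric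
  compatibility vanishes.\<close>

lemma nab_skew:
  assumes X: "X \<in> lie_algebra G A" and Y: "Y \<in> lie_algebra G A" and Z: "Z \<in> lie_algebra G A"
  shows "g p (nab X Y p) (Z p) = - g p (nab X Z p) (Y p)"
proof -
  note vf = X[THEN lie_algebra_vfield] Y[THEN lie_algebra_vfield] Z[THEN lie_algebra_vfield]
  have "X p (\<lambda>q. g q (Y q) (Z q)) = X p (\<lambda>q. g \<one> (Y \<one>) (Z \<one>))"
    by (rule arg_cong[of _ _ "X p"]) (rule ext, rule metric_lie_algebra_const[OF Y Z])
  also have "\<dots> = 0" using tangent_space_const[OF manifold vfieldsD(1)[OF vf(1)]] .
  finally have "g p (nab X Y p) (Z p) + g p (Y p) (nab X Z p) = 0"
    unfolding metric_compatible[OF vf] .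
  moreover have "g p (Y p) (nab X Z p) = g p (nab X Z p) (Y p)"
    by (intro metric_sym vfieldsD(1) nab_vfield vf)
  ultimately show ?thesis by simp
qed

text \<open>Expand the brackets by vanishing torsion. Of the six resulting products, skewness
  cancels two pairs and makes the remaining two equal.\<close>

lemma koszul:
  assumes X: "X \<in> lie_algebra G A" and Y: "Y \<in> lie_algebra G A" and Z: "Z \<in> lie_algebra G A"
  shows "2 * g p (nab X Y p) (Z p) = g p (lie_bracket X Y p) (Z p)
    - g p (lie_bracket Y Z p) (X p) + g p (lie_bracket Z X p) (Y p)"
proof -
  have bracket: "g p (lie_bracket U V p) (W p) = g p (nab U V p) (W p) - g p (nab V U p) (W p)"
    if "U \<in> lie_algebra G A" "V \<in> lie_algebra G A" "W \<in> lie_algebra G A" for U V W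
  proof -
    note vf = that[THEN lie_algebra_vfield]
    have "nab U V p \<in> T p" "nab V U p \<in> T p" "W p \<in> T p"
      by (intro vfieldsD(1) nab_vfield vf)+
    then show ?thesis
      unfolding torsion_free[OF vf(1,2)] vf_diff_conv_lincomb by (simp add: metric_lincomb)
  qed
  show ?thesis
    unfolding bracket[OF X Y Z] bracket[OF Y Z X] bracket[OF Z X Y]
    using nab_skew[OF X Y Z, of p] nab_skew[OF Y Z X, of p] nab_skew[OF Z X Y, of p] by simp
qed

text \<open>Bi-invariance takes J out of the first slot of the bracket, antisymmetry transfers this
  to the second slot, and symmetry of J moves it to the other side of the metric.\<close>

lemma lie_bracket_J:
  assumes X: "X \<in> lie_algebra G A" and Y: "Y \<in> lie_algebra G A" and Z: "Z \<in> lie_algebra G A"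
  shows "g p (lie_bracket (apply_endo J X) Y p) (Z p) = g p (lie_bracket X Y p) (apply_endo J Z p)"
    "g p (lie_bracket X (apply_endo J Y) p) (Z p) = g p (lie_bracket X Y p) (apply_endo J Z p)"
proof -
  note vf = X[THEN lie_algebra_vfield] Y[THEN lie_algebra_vfield] Z[THEN lie_algebra_vfield]
  have br: "lie_bracket U V p \<in> T p" if "U \<in> vfields A" "V \<in> vfields A" for U V
    unfolding torsion_free[OF that] vf_diff_conv_lincomb
    by (intro lincomb_in_tangent_space vfieldsD(1) nab_vfield that)
  have left: "g p (lie_bracket (apply_endo J U) V p) (Z p) = g p (lie_bracket U V p) (apply_endo J Z p)"
    if "U \<in> lie_algebra G A" "V \<in> lie_algebra G A" for U V
  proof -
    have "lie_bracket (apply_endo J U) V = apply_endo J (lie_bracket U V)"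
      using bi_inv that unfolding bi_invariant_def by blast
    then show ?thesis
      using J_symmetric[OF br vfieldsD(1)[OF vf(3)], of U V] that lie_algebra_vfield
      by (simp add: apply_endo_def)
  qed
  then show "g p (lie_bracket (apply_endo J X) Y p) (Z p) = g p (lie_bracket X Y p) (apply_endo J Z p)"
    using X Y by blast
  have anti: "g p (lie_bracket U V p) (W p) = - g p (lie_bracket V U p) (W p)"
    if "U \<in> vfields A" "V \<in> vfields A" "W \<in> vfields A" for U V W
  proof -
    have "lie_bracket U V p = lincomb (-1) (lie_bracket V U p) 0 (lie_bracket V U p)"
      by (simp add: lie_bracket_def lincomb_def)
    then show ?thesis
      using metric_lincomb[OF br br vfieldsD(1)[OF that(3)]] that by simp
  qed
  show "g p (lie_bracket X (apply_endo J Y) p) (Z p) = g p (lie_bracket X Y p) (apply_endo J Z p)"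
    unfolding anti[OF vf(1) J_vfield[OF vf(2)] vf(3)] anti[OF vf(1,2) J_vfield[OF vf(3)]]
      left[OF Y X] ..
qed

lemma cov_deriv_endo_lie_algebra:
  assumes X: "X \<in> lie_algebra G A" and Y: "Y \<in> lie_algebra G A"
  shows "cov_deriv_endo nab J X Y = (\<lambda>p f. 0)"
proof (rule ext, rule metric_nondegenerate)
  note vf = X[THEN lie_algebra_vfield] Y[THEN lie_algebra_vfield]
  fix p
  show "cov_deriv_endo nab J X Y p \<in> T p" using cov_deriv_endo_tangent[OF vf] .
  fix u assume u: "u \<in> T p"
  obtain Z where Z: "Z \<in> lie_algebra G A" "Z p = u" using lie_algebra_through[OF u] .
  \<comment> \<open>The two Koszul expressions agree term by term: \<open>lie_bracket_J\<close>
    brings both to g([X,Y],JZ), g([Y,Z],JX) and g([Z,X],JY).\<close>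
  have "2 * g p (nab X (apply_endo J Y) p) (Z p) = 2 * g p (nab X Y p) (apply_endo J Z p)"
    unfolding koszul[OF X J_lie_algebra[OF Y] Z(1)] koszul[OF X Y J_lie_algebra[OF Z(1)]]
      lie_bracket_J[OF X Y Z(1)] lie_bracket_J[OF Y Z(1) X] lie_bracket_J[OF Z(1) X Y] ..
  then show "g p (cov_deriv_endo nab J X Y p) u = 0"
    unfolding metric_cov_deriv_endo[OF vf u] using Z(2) by (simp add: apply_endo_def)
qed

text \<open>Expand X in a left invariant frame. The coefficients are products with the dual frame,
  smooth because the metric is, so linearity over functions reduces the claim to the frame
  fields.\<close>

lemma cov_deriv_endo_lie_algebra_right:
  assumes X: "X \<in> vfields A" and Z: "Z \<in> lie_algebra G A"
  shows "cov_deriv_endo nab J X Z = (\<lambda>p f. 0)"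
proof -
  obtain E D :: "'e \<Rightarrow> 'a vfield"
    where E: "\<And>b. E b \<in> lie_algebra G A" and D: "\<And>b. D b \<in> lie_algebra G A"
      and frame: "\<And>p u. u \<in> T p \<Longrightarrow> u = (\<lambda>f. \<Sum>b\<in>Basis. g p (D b p) u * E b p f)"
    using left_invariant_dual_frames[OF metric left_metric] by blast
  let ?h = "\<lambda>b p. g p (D b p) (X p)"
  have "X = (\<lambda>p f. \<Sum>b\<in>Basis. ?h b p * E b p f)"
    by (rule ext) (rule frame[OF vfieldsD(1)[OF X]])
  moreover have "cov_deriv_endo nab J (\<lambda>p f. \<Sum>b\<in>Basis. ?h b p * E b p f) Z = (\<lambda>p f. 0)"
  proof (rule conjunct2[OF cov_deriv_endo_sum_left])
    show "?h b \<in> smooth_functions A" for b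
      using metric lie_algebra_vfield[OF D] X unfolding pseudo_riemannian_def by blast
  qed (simp_all add: cov_deriv_endo_lie_algebra E Z lie_algebra_vfield)
  ultimately show ?thesis by (rule ssubst[where P = "\<lambda>X. cov_deriv_endo nab J X Z = (\<lambda>p f. 0)"])
qed

lemma parallel_J: "parallel_endo A nab J"
  unfolding parallel_endo_def
proof (intro ballI ext[of "cov_deriv_endo nab J _ _"] metric_nondegenerate)
  fix X Y p u assume X: "X \<in> vfields A" and Y: "Y \<in> vfields A"
  show "cov_deriv_endo nab J X Y p \<in> T p" using cov_deriv_endo_tangent[OF X Y] .
  assume u: "u \<in> T p"
  obtain Z where Z: "Z \<in> lie_algebra G A" "Z p = u" using lie_algebra_through[OF u] .
  note vf = lie_algebra_vfield[OF Z(1)]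
  \<comment> \<open>Symmetry moves the derivative from Y onto the left invariant Z through
    \<open>u\<close>, where it is already known to vanish.\<close>
  have "g p (cov_deriv_endo nab J X Y p) u = g p (Y p) (\<lambda>f. 0)"
    using cov_deriv_endo_symmetric[OF X Y vf, of p]
    unfolding cov_deriv_endo_lie_algebra_right[OF X Z(1)] Z(2) .
  also have "\<dots> = g p (\<lambda>f. 0) (Y p)"
    using metric_sym[OF vfieldsD(1)[OF Y] cov_deriv_endo_tangent[OF X vf]]
    unfolding cov_deriv_endo_lie_algebra_right[OF X Z(1)] .
  \<comment> \<open>The zero vector is written as a linear combination of tangent vectors so that
    linearity of the metric applies to it.\<close>
  also have "\<dots> = g p (lincomb 0 (Y p) 0 (Y p)) (Y p)" by (simp add: lincomb_def)
  also have "\<dots> = 0" using metric_lincomb[of "Y p" p "Y p" "Y p" 0 0] vfieldsD(1)[OF Y] by simp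
  finally show "g p (cov_deriv_endo nab J X Y p) u = 0" .
qed

end

theorem proposition3p2:
  fixes G :: "('a::{t2_space,second_countable_topology}) monoid"
    and A :: "('a, 'e::euclidean_space) chart set"
    and g :: "'a bilin_field"
    and J :: "'a endo_field"
  assumes "lie_group G A"
    and "almost_anti_hermitian A g J"
    and "left_inv_metric G A g"
    and "left_inv_endo G A J"
    and "bi_invariant G A J"
  shows "anti_kaehler A g J"
proof -
  have manifold: "smooth_manifold A" using assms(1) unfolding lie_group_def by blast
  have "parallel_endo A nab J" if "levi_civita A g nab" for nab
  proof -
    interpret bi_invariant_connection G A g J nab
      by unfold_locales (use assms that manifold in auto)
    show ?thesis by (rule parallel_J)
  qed
  then show ?thesis using manifold assms(2) unfolding anti_kaehler_def by blast
qed

end
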